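(* Let $\widetilde{\mathbf{x}}_t$, $t\in[0,t_{\max}]$, be the $\mathbb{R}^N$-valued process $d\widetilde{\mathbf{x}}_t=\sqrt{2q(t)q'(t)}\,d\boldsymbol{W}_t$ with $\widetilde{\mathbf{x}}_0=\mathbf{x}_0$ and $q(t)=\kappa t$, $\kappa>0$. Let $\sigma>0$, $\boldsymbol{A}_t:=\big(\boldsymbol{I}+\frac{q(t)^2}{\sigma^2}\boldsymbol{L}_\delta\big)^{-1/2}$, and $\mathbf{x}_t=\boldsymbol{A}_t\widetilde{\mathbf{x}}_t$. Then the graph-Fourier modes $x_{t,i}=[\boldsymbol{U}^\top\mathbf{x}_t]_i$, $i=1,\dots,N$, satisfy the linear stochastic differential equation $$dx_{t,i}=-\mu_i c_i(t)\,x_{t,i}\,dt+\sqrt{2\sigma^2c_i(t)}\,dW_{t,i},\qquad W_{t,i}:=[\boldsymbol{U}^\top\boldsymbol{W}_t]_i,$$ with $$c_i(t)=\frac{q(t)q'(t)}{\sigma^2+\mu_i q(t)^2}.$$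
   Context: Graph setting: $\mathcal{G}$ is a fixed undirected weighted graph on $N$ nodes with symmetric nonnegative adjacency matrix $\boldsymbol{W}$, diagonal degree matrix $\boldsymbol{D}$, $\boldsymbol{D}_{ii}=\sum_j\boldsymbol{W}_{ij}$, and symmetric normalized Laplacian $\boldsymbol{L}=\boldsymbol{I}-\boldsymbol{D}^{-1/2}\boldsymbol{W}\boldsymbol{D}^{-1/2}$, which is symmetric positive semidefinite with eigendecomposition $\boldsymbol{L}=\boldsymbol{U}\,\mathrm{diag}(\lambda_1,\dots,\lambda_N)\,\boldsymbol{U}^\top$, $\boldsymbol{U}^\top\boldsymbol{U}=\boldsymbol{I}$, $\lambda_i\ge 0$, and largest eigenvalue $\lambda_{\max}>0$. For a fixed $\delta>0$, $\boldsymbol{L}_\delta=\boldsymbol{L}/\lambda_{\max}+\delta\boldsymbol{I}=\boldsymbol{U}\,\mathrm{diag}(\mu_1,\dots,\mu_N)\,\boldsymbol{U}^\top$ with $\mu_i=\lambda_i/\lambda_{\max}+\delta>0$. $\boldsymbol{W}_t$ (with time index) is a standard $N$-dimensional Brownian motion independent of the random initial signal $\mathbf{x}_0\in\mathbb{R}^N$; consequently the $W_{t,i}$ are independent standard one-dimensional Brownian motions. *)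

theory Defs
  imports "HOL-Probability.Probability"
begin

section \<open>Matrices and the graph Laplacian\<close>

definition diag_matrix :: "('n \<Rightarrow> real) \<Rightarrow> real^'n^'n" where
  "diag_matrix d = (\<chi> i j. if i = j then d i else 0)"

definition pos_semidef :: "real^'n^'n \<Rightarrow> bool" where
  "pos_semidef A \<longleftrightarrow> transpose A = A \<and> (\<forall>v. 0 \<le> v \<bullet> (A *v v))"

definition psd_sqrt :: "real^'n^'n \<Rightarrow> real^'n^'n" where
  "psd_sqrt A = (THE B. pos_semidef B \<and> B ** B = A)"

text \<open>The power \<open>A\<^sup>-\<^sup>1\<^sup>/\<^sup>2\<close>, meant for symmetric positive definite \<open>A\<close> only.\<close>

definition inv_sqrt_matrix :: "real^'n^'n \<Rightarrow> real^'n^'n" where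
  "inv_sqrt_matrix A = matrix_inv (psd_sqrt A)"

definition node_degree :: "real^'n^'n \<Rightarrow> 'n \<Rightarrow> real" where
  "node_degree Adj i = (\<Sum>j\<in>UNIV. Adj $ i $ j)"

text \<open>Since \<open>0 powr a = 0\<close>, a node of degree \<open>0\<close> contributes the entry \<open>0\<close> to \<open>D\<^sup>-\<^sup>1\<^sup>/\<^sup>2\<close>,
  the usual convention for isolated nodes.\<close>

definition norm_laplacian :: "real^'n^'n \<Rightarrow> real^'n^'n" where
  "norm_laplacian Adj =
     (let Dm = diag_matrix (\<lambda>i. node_degree Adj i powr (- 1/2)) in mat 1 - Dm ** Adj ** Dm)"


section \<open>Filtrations and Brownian motion\<close>

text \<open>Processes are indexed by \<open>real\<close>; only their values at times \<open>t \<ge> 0\<close> matter.\<close>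

definition rv_events :: "'a measure \<Rightarrow> ('a \<Rightarrow> 'b::topological_space) \<Rightarrow> 'a set set" where
  "rv_events M X = sets (vimage_algebra (space M) X borel)"

definition natural_filtration ::
  "'a measure \<Rightarrow> (real \<Rightarrow> 'a \<Rightarrow> 'b::topological_space) \<Rightarrow> real \<Rightarrow> 'a measure" where
  "natural_filtration M W t = sigma (space M) (\<Union>s\<in>{0..t}. rv_events M (W s))"

text \<open>The filtration generated by \<open>X0\<close>, \<open>W\<close> and the null sets. The null sets are needed because
  stochastic integrals are determined only almost surely.\<close>

definition augmented_filtration ::
  "'a measure \<Rightarrow> ('a \<Rightarrow> 'c::topological_space) \<Rightarrow> (real \<Rightarrow> 'a \<Rightarrow> 'b::topological_space)
     \<Rightarrow> real \<Rightarrow> 'a measure" where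
  "augmented_filtration M X0 W t =
     sigma (space M) (rv_events M X0 \<union> (\<Union>s\<in>{0..t}. rv_events M (W s)) \<union> null_sets M)"

definition rv_indep_process ::
  "'a measure \<Rightarrow> ('a \<Rightarrow> 'c::topological_space) \<Rightarrow> (real \<Rightarrow> 'a \<Rightarrow> 'b::topological_space) \<Rightarrow> bool" where
  "rv_indep_process M X0 W \<longleftrightarrow>
     prob_space.indep_set M (rv_events M X0)
       (sigma_sets (space M) (\<Union>s\<in>{0..}. rv_events M (W s)))"

text \<open>Standard Brownian motion with respect to the filtration \<open>F\<close>, in the Euclidean space \<open>'b\<close>:
  the increment over \<open>[s,t]\<close> is independent of \<open>F s\<close> and has law \<open>N(0, (t - s) I)\<close>. For
  \<open>'b = real\<close> this is one-dimensional Brownian motion.\<close>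

definition brownian_motion ::
  "'a measure \<Rightarrow> (real \<Rightarrow> 'a measure) \<Rightarrow> (real \<Rightarrow> 'a \<Rightarrow> 'b::euclidean_space) \<Rightarrow> bool" where
  "brownian_motion M F W \<longleftrightarrow>
     filtration (space M) F \<and> (\<forall>t. subalgebra M (F t)) \<and>
     (\<forall>t\<ge>0. W t \<in> borel_measurable (F t)) \<and>
     (AE \<omega> in M. W 0 \<omega> = 0) \<and>
     (AE \<omega> in M. continuous_on {0..} (\<lambda>t. W t \<omega>)) \<and>
     (\<forall>s t. 0 \<le> s \<and> s < t \<longrightarrow>
        prob_space.indep_set M (sets (F s)) (rv_events M (\<lambda>\<omega>. W t \<omega> - W s \<omega>)) \<and>
        prob_space.indep_vars M (\<lambda>_. borel) (\<lambda>b \<omega>. (W t \<omega> - W s \<omega>) \<bullet> b) Basis \<and>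
        (\<forall>b\<in>Basis. distributed M lborel (\<lambda>\<omega>. (W t \<omega> - W s \<omega>) \<bullet> b)
                      (\<lambda>x. ennreal (normal_density 0 (sqrt (t - s)) x))))"


section \<open>Ito integral\<close>

text \<open>A simple process on \<open>[0,T]\<close> is \<open>\<Sum>k<n. \<xi> k \<cdot> 1\<close> on \<open>(\<tau> k, \<tau> (k + 1)]\<close> with bounded
  \<open>F (\<tau> k)\<close>-measurable \<open>\<xi> k\<close>.\<close>

definition simple_process ::
  "'a measure \<Rightarrow> (real \<Rightarrow> 'a measure) \<Rightarrow> real \<Rightarrow> nat \<Rightarrow> (nat \<Rightarrow> real) \<Rightarrow> (nat \<Rightarrow> 'a \<Rightarrow> real) \<Rightarrow> bool" where
  "simple_process M F T n \<tau> \<xi> \<longleftrightarrow>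
     (\<forall>k\<le>n. 0 \<le> \<tau> k \<and> \<tau> k \<le> T) \<and>
     (\<forall>k<n. \<tau> k \<le> \<tau> (Suc k) \<and> \<xi> k \<in> borel_measurable (F (\<tau> k)) \<and>
        (\<exists>B. \<forall>\<omega>\<in>space M. \<bar>\<xi> k \<omega>\<bar> \<le> B))"

definition simple_value ::
  "nat \<Rightarrow> (nat \<Rightarrow> real) \<Rightarrow> (nat \<Rightarrow> 'a \<Rightarrow> real) \<Rightarrow> real \<Rightarrow> 'a \<Rightarrow> real" where
  "simple_value n \<tau> \<xi> u \<omega> = (\<Sum>k<n. \<xi> k \<omega> * indicator {\<tau> k<..\<tau> (Suc k)} u)"

definition simple_integral ::
  "(real \<Rightarrow> 'a \<Rightarrow> 'b::real_vector) \<Rightarrow> nat \<Rightarrow> (nat \<Rightarrow> real) \<Rightarrow> (nat \<Rightarrow> 'a \<Rightarrow> real) \<Rightarrow> 'a \<Rightarrow> 'b" where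
  "simple_integral W n \<tau> \<xi> \<omega> = (\<Sum>k<n. \<xi> k \<omega> *\<^sub>R (W (\<tau> (Suc k)) \<omega> - W (\<tau> k) \<omega>))"

text \<open>\<open>I\<close> is a version of the Ito integral over \<open>[0,T]\<close> of the scalar integrand \<open>H\<close> with respect
  to \<open>W\<close>: the \<open>L\<^sup>2(P)\<close>-limit of integrals of simple processes that tend to \<open>H\<close> in
  \<open>L\<^sup>2(P \<times> dt)\<close>. Existence of such processes makes \<open>H\<close> square integrable; by the Ito isometry \<open>I\<close>
  is almost surely unique if \<open>W\<close> is an \<open>F\<close>-Brownian motion.\<close>

definition has_ito_integral ::
  "'a measure \<Rightarrow> (real \<Rightarrow> 'a measure) \<Rightarrow> (real \<Rightarrow> 'a \<Rightarrow> 'b::euclidean_space) \<Rightarrow> real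
     \<Rightarrow> (real \<Rightarrow> 'a \<Rightarrow> real) \<Rightarrow> ('a \<Rightarrow> 'b) \<Rightarrow> bool" where
  "has_ito_integral M F W T H I \<longleftrightarrow>
     (\<lambda>(\<omega>, u). H u \<omega>) \<in> borel_measurable (M \<Otimes>\<^sub>M restrict_space lborel {0..T}) \<and>
     (\<forall>u\<in>{0..T}. H u \<in> borel_measurable (F u)) \<and>
     I \<in> borel_measurable M \<and>
     (\<exists>n \<tau> \<xi>. (\<forall>m. simple_process M F T (n m) (\<tau> m) (\<xi> m)) \<and>
        (\<lambda>m. \<integral>\<^sup>+\<omega>. (\<integral>\<^sup>+u\<in>{0..T}. ennreal ((simple_value (n m) (\<tau> m) (\<xi> m) u \<omega> - H u \<omega>)\<^sup>2) \<partial>lborel) \<partial>M)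
          \<longlonglongrightarrow> 0 \<and>
        (\<lambda>m. \<integral>\<^sup>+\<omega>. ennreal ((norm (simple_integral W (n m) (\<tau> m) (\<xi> m) \<omega> - I \<omega>))\<^sup>2) \<partial>M)
          \<longlonglongrightarrow> 0)"


section \<open>Stochastic differential equations\<close>

text \<open>\<open>X\<close> solves \<open>dX = b(t, X) dt + s(t, X) dW\<close> on \<open>[0,T]\<close>, where \<open>s\<close> is scalar (that is, the
  diffusion matrix is \<open>s I\<close>). As paths are continuous, it is enough to require the integral
  equation almost surely at each fixed time.\<close>

definition sde_solution ::
  "'a measure \<Rightarrow> (real \<Rightarrow> 'a measure) \<Rightarrow> (real \<Rightarrow> 'a \<Rightarrow> 'b::euclidean_space) \<Rightarrow> real
     \<Rightarrow> (real \<Rightarrow> 'b \<Rightarrow> 'b) \<Rightarrow> (real \<Rightarrow> 'b \<Rightarrow> real) \<Rightarrow> (real \<Rightarrow> 'a \<Rightarrow> 'b) \<Rightarrow> bool" where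
  "sde_solution M F W T b s X \<longleftrightarrow>
     brownian_motion M F W \<and>
     (\<forall>t\<in>{0..T}. X t \<in> borel_measurable (F t)) \<and>
     (AE \<omega> in M. continuous_on {0..T} (\<lambda>t. X t \<omega>)) \<and>
     (AE \<omega> in M. set_integrable lborel {0..T} (\<lambda>u. b u (X u \<omega>))) \<and>
     (\<forall>t\<in>{0..T}. \<exists>I. has_ito_integral M F W t (\<lambda>u \<omega>. s u (X u \<omega>)) I \<and>
        (AE \<omega> in M. X t \<omega> = X 0 \<omega> + (LINT u:{0..t}|lborel. b u (X u \<omega>)) + I \<omega>))"

end

theory Submission
  imports Defs
begin

text \<open>The matrix \<open>A t\<close> is diagonal in the basis of columns of \<open>U\<close>, so the \<open>i\<close>-th mode is \<open>a t * y t\<close> with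
  \<open>a t = (1 + \<mu> i * (q t)\<^sup>2 / \<sigma>\<^sup>2) powr (-1/2)\<close> deterministic and \<open>y\<close> the \<open>i\<close>-th mode of \<open>xt\<close>, which
  satisfies \<open>dy = h dW\<close>. The claim is the product rule \<open>d(a y) = a' y dt + a h dW\<close>. Summation by parts
  over a partition of \<open>[0,t]\<close> writes \<open>a t * y t - a 0 * y 0\<close> as a Riemann-Stieltjes sum of \<open>y\<close> against
  \<open>a\<close>, which converges pathwise, plus \<open>\<Sum>k. a (t k) * (y (t (k + 1)) - y (t k))\<close>, the stochastic
  integral of \<open>a h\<close> with \<open>a\<close> replaced by a step function. By the Ito isometry and Fatou's lemma the
  almost sure limit of the latter is the Ito integral of \<open>a h\<close>.\<close>

section \<open>Diagonalised matrices and the Laplacian\<close>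

text \<open>The obstacle is that \<open>has_ito_integral\<close> asks for simple processes
  integrated against the Brownian motion itself, whereas summation by parts produces increments of
  the given integrals of \<open>h\<close>. The coefficient \<open>h u\<close>, equal to \<kappa>
  times the square root of 2u, is continuous but not differentiable at 0, so it cannot be moved to
  the deterministic factor by a second integration by parts. Hence two approximations of the same
  integrand: one samples only \<open>a\<close> and converges almost surely, the other samples
  \<open>a * h\<close> and consists of genuine simple processes. The predicate
  \<open>wiener_integral\<close> covers both kinds and is closed under linear combinations, so they
  can be compared; as the integrands are deterministic, the comparison reduces to distances in
  L2(dt). No moment of \<open>x0\<close> is assumed finite. The mode \<open>y\<close> is therefore
  treated path by path, and only the stochastic integrals are estimated in L2(P). A mode is the
  projection on a unit column of \<open>U\<close>, so the scalar Brownian motion keeps the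
  filtration of the vector one, including \<open>x0\<close> and the null sets.\<close>

lemma diag_matrix_mult_vec: "(diag_matrix d *v v) $ i = d i * v $ i"
  by (simp add: diag_matrix_def matrix_vector_mult_def if_distrib[of "\<lambda>x. x * _"] cong: if_cong)

lemma diag_matrix_mult: "diag_matrix d ** diag_matrix e = diag_matrix (\<lambda>i. d i * e i)"
  by (rule matrix_eq[THEN iffD2])
     (auto simp: vec_eq_iff diag_matrix_mult_vec simp flip: matrix_vector_mul_assoc)

lemma transpose_diag_matrix: "transpose (diag_matrix d) = diag_matrix d"
  by (simp add: transpose_def diag_matrix_def vec_eq_iff)

lemma diag_matrix_one: "diag_matrix (\<lambda>_. 1) = mat 1"
  by (simp add: diag_matrix_def mat_def vec_eq_iff)

lemma conjugate_diag_mult: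
  fixes U :: "real^'n^'n"
  assumes "transpose U ** U = mat 1"
  shows "(U ** diag_matrix d ** transpose U) ** (U ** diag_matrix e ** transpose U)
    = U ** diag_matrix (\<lambda>i. d i * e i) ** transpose U"
proof -
  have "(U ** diag_matrix d ** transpose U) ** (U ** diag_matrix e ** transpose U)
    = U ** diag_matrix d ** (transpose U ** U) ** diag_matrix e ** transpose U"
    by (simp add: matrix_mul_assoc)
  then show ?thesis
    by (simp add: assms flip: matrix_mul_assoc diag_matrix_mult)
qed

lemma pos_semidef_conjugate_diag:
  fixes U :: "real^'n^'n"
  assumes "\<And>i. 0 \<le> d i"
  shows "pos_semidef (U ** diag_matrix d ** transpose U)"
  unfolding pos_semidef_def
proof (intro conjI allI)
  show "transpose (U ** diag_matrix d ** transpose U) = U ** diag_matrix d ** transpose U"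
    by (simp add: matrix_transpose_mul transpose_diag_matrix matrix_mul_assoc)
  fix v
  have "v \<bullet> ((U ** diag_matrix d ** transpose U) *v v)
      = (transpose U *v v) \<bullet> (diag_matrix d *v (transpose U *v v))"
    by (simp add: dot_lmul_matrix vector_transpose_matrix flip: matrix_vector_mul_assoc)
  also have "\<dots> \<ge> 0"
    by (auto simp: inner_vec_def diag_matrix_mult_vec assms mult.left_commute intro!: sum_nonneg)
  finally show "0 \<le> v \<bullet> ((U ** diag_matrix d ** transpose U) *v v)" .
qed

text \<open>Factor B^2 - r^2 = (B + r)(B - r): the vector w = (B - r) v satisfies B w = - r w, and a
  positive semidefinite B has no negative eigenvalue, so w = 0. This is the uniqueness part of the
  square root, one eigenvector at a time.\<close>

lemma pos_semidef_sqrt_eigenvector: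
  fixes B :: "real^'n^'n"
  assumes "pos_semidef B" and "B *v (B *v v) = r\<^sup>2 *\<^sub>R v" and "0 < r"
  shows "B *v v = r *\<^sub>R v"
proof -
  define w where "w = B *v v - r *\<^sub>R v"
  have "B *v w = - r *\<^sub>R w"
    by (simp add: w_def matrix_vector_mult_diff_distrib assms(2) power2_eq_square
        matrix_vector_mult_scaleR scaleR_diff_right)
  moreover have "0 \<le> w \<bullet> (B *v w)"
    using assms(1) by (simp add: pos_semidef_def)
  ultimately have "r * (w \<bullet> w) \<le> 0" by simp
  with assms(3) have "w = 0"
    by (simp add: mult_le_0_iff) (metis inner_gt_zero_iff not_less)
  then show ?thesis by (simp add: w_def)
qed

text \<open>\<open>psd_sqrt\<close> is a definite description, so uniqueness has to be proved along
  with existence. The columns of \<open>U\<close> are eigenvectors of \<open>B ** B\<close>, with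
  eigenvalues that are squares of positive numbers; this forces the value of any root
  \<open>B\<close> on each of them, and \<open>U\<close> is invertible.\<close>

lemma psd_sqrt_conjugate_diag:
  fixes U :: "real^'n^'n"
  assumes U: "transpose U ** U = mat 1" and d: "\<And>i. 0 < d i"
  shows "psd_sqrt (U ** diag_matrix d ** transpose U)
    = U ** diag_matrix (\<lambda>i. sqrt (d i)) ** transpose U"
  unfolding psd_sqrt_def
proof (rule the_equality)
  show "pos_semidef (U ** diag_matrix (\<lambda>i. sqrt (d i)) ** transpose U) \<and>
    U ** diag_matrix (\<lambda>i. sqrt (d i)) ** transpose U ** (U ** diag_matrix (\<lambda>i. sqrt (d i)) ** transpose U)
    = U ** diag_matrix d ** transpose U"
    using d by (simp add: conjugate_diag_mult[OF U] pos_semidef_conjugate_diag less_imp_le)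
next
  fix B assume B: "pos_semidef B \<and> B ** B = U ** diag_matrix d ** transpose U"
  have U': "U ** transpose U = mat 1"
    using U by (simp add: matrix_left_right_inverse)
  have BBU: "B ** B ** U = U ** diag_matrix d"
    using B U by (simp flip: matrix_mul_assoc)
  have "B *v (U *v axis i 1) = (U ** diag_matrix (\<lambda>i. sqrt (d i))) *v axis i 1" for i
  proof -
    have ax: "diag_matrix e *v axis i 1 = e i *\<^sub>R axis i 1" for e :: "'n \<Rightarrow> real"
      by (auto simp: vec_eq_iff diag_matrix_mult_vec axis_def)
    have "B *v (B *v (U *v axis i 1)) = (U ** diag_matrix d) *v axis i 1"
      unfolding BBU[symmetric] by (simp add: matrix_vector_mul_assoc matrix_mul_assoc)
    also have "\<dots> = (sqrt (d i))\<^sup>2 *\<^sub>R (U *v axis i 1)"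
      using d[of i]
      by (simp add: ax matrix_vector_mult_scaleR less_imp_le flip: matrix_vector_mul_assoc)
    finally have "B *v (U *v axis i 1) = sqrt (d i) *\<^sub>R (U *v axis i 1)"
      using B d[of i] by (intro pos_semidef_sqrt_eigenvector) auto
    then show ?thesis
      by (simp add: ax matrix_vector_mult_scaleR flip: matrix_vector_mul_assoc)
  qed
  then have "column i (B ** U) = column i (U ** diag_matrix (\<lambda>i. sqrt (d i)))" for i
    by (metis matrix_vector_mul_assoc matrix_vector_mult_basis)
  then have "B ** U = U ** diag_matrix (\<lambda>i. sqrt (d i))"
    by (simp add: vec_eq_iff column_def)
  then have "B ** (U ** transpose U) = U ** diag_matrix (\<lambda>i. sqrt (d i)) ** transpose U"
    by (simp add: matrix_mul_assoc)
  then show "B = U ** diag_matrix (\<lambda>i. sqrt (d i)) ** transpose U"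
    by (simp add: U')
qed

lemma matrix_inv_eqI:
  fixes A :: "real^'n^'n"
  assumes "A ** B = mat 1" and "B ** A = mat 1"
  shows "matrix_inv A = B"
proof -
  have "\<exists>A'. A ** A' = mat 1 \<and> A' ** A = mat 1"
    using assms by blast
  then have "A ** matrix_inv A = mat 1"
    unfolding matrix_inv_def by (rule someI2_ex) simp
  then have "B ** A ** matrix_inv A = B"
    by (simp flip: matrix_mul_assoc)
  then show ?thesis
    by (simp add: assms(2))
qed

lemma inv_sqrt_matrix_conjugate_diag:
  fixes U :: "real^'n^'n"
  assumes U: "transpose U ** U = mat 1" and d: "\<And>i. 0 < d i"
  shows "inv_sqrt_matrix (U ** diag_matrix d ** transpose U)
    = U ** diag_matrix (\<lambda>i. 1 / sqrt (d i)) ** transpose U"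
  unfolding inv_sqrt_matrix_def psd_sqrt_conjugate_diag[OF assms]
proof (rule matrix_inv_eqI)
  have U': "U ** transpose U = mat 1"
    using U by (simp add: matrix_left_right_inverse)
  have d': "sqrt (d i) \<noteq> 0" for i using d[of i] by simp
  show "U ** diag_matrix (\<lambda>i. sqrt (d i)) ** transpose U
      ** (U ** diag_matrix (\<lambda>i. 1 / sqrt (d i)) ** transpose U) = mat 1"
    "U ** diag_matrix (\<lambda>i. 1 / sqrt (d i)) ** transpose U
      ** (U ** diag_matrix (\<lambda>i. sqrt (d i)) ** transpose U) = mat 1"
    using d' by (simp_all add: conjugate_diag_mult[OF U] diag_matrix_one U')
qed

text \<open>The inequality 2xy \<le> x^2 + y^2, weighted by the nonnegative entries of
  \<open>Adj\<close>, bounds the quadratic form of the normalised adjacency matrix. By symmetry both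
  halves of the bound equal the sum of
  \<open>(e i)\<^sup>2 * node_degree Adj i * (v $ i)\<^sup>2\<close>, which is at most
  \<open>v \<bullet> v\<close>.\<close>

lemma norm_laplacian_nonneg:
  fixes Adj :: "real^'n^'n"
  assumes sym: "transpose Adj = Adj" and nn: "\<And>i j. 0 \<le> Adj $ i $ j"
  shows "0 \<le> v \<bullet> (norm_laplacian Adj *v v)"
proof -
  define e where "e i = node_degree Adj i powr (- 1/2)" for i
  have sym': "Adj $ i $ j = Adj $ j $ i" for i j
    using sym by (metis transpose_def vec_lambda_beta)
  have deg: "0 \<le> node_degree Adj i" for i
    by (auto simp: node_degree_def nn intro: sum_nonneg)
  \<comment> \<open>Only an inequality: the product is 1 at nodes of positive degree, but 0 at
    isolated nodes, where \<open>e i = 0\<close>.\<close>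
  have e2: "(e i)\<^sup>2 * node_degree Adj i \<le> 1" for i
  proof (cases "node_degree Adj i = 0")
    case False
    then have "(e i)\<^sup>2 = 1 / node_degree Adj i"
      using deg[of i] by (simp add: e_def power2_eq_square powr_minus_divide flip: powr_add)
    with False show ?thesis by simp
  qed simp
  have diag_le: "(\<Sum>i\<in>UNIV. \<Sum>j\<in>UNIV. Adj $ i $ j * (e i * v $ i)\<^sup>2) \<le> v \<bullet> v"
  proof -
    have "(\<Sum>j\<in>UNIV. Adj $ i $ j * (e i * v $ i)\<^sup>2) \<le> (v $ i)\<^sup>2" for i
    proof -
      have "(\<Sum>j\<in>UNIV. Adj $ i $ j * (e i * v $ i)\<^sup>2) = ((e i)\<^sup>2 * node_degree Adj i) * (v $ i)\<^sup>2"
        by (simp add: node_degree_def sum_distrib_left sum_distrib_right power_mult_distrib algebra_simps)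
      also have "\<dots> \<le> 1 * (v $ i)\<^sup>2"
        by (intro mult_right_mono e2) simp
      finally show ?thesis by simp
    qed
    then show ?thesis
      by (auto simp: inner_vec_def power2_eq_square intro!: sum_mono)
  qed
  have "v \<bullet> ((diag_matrix e ** Adj ** diag_matrix e) *v v)
      = (\<Sum>i\<in>UNIV. \<Sum>j\<in>UNIV. Adj $ i $ j * ((e i * v $ i) * (e j * v $ j)))"
    by (simp add: inner_vec_def diag_matrix_mult_vec matrix_vector_mult_def[of Adj]
        sum_distrib_left algebra_simps flip: matrix_vector_mul_assoc)
  also have "\<dots> \<le> (\<Sum>i\<in>UNIV. \<Sum>j\<in>UNIV. Adj $ i $ j * (((e i * v $ i)\<^sup>2 + (e j * v $ j)\<^sup>2) / 2))"
  proof (intro sum_mono mult_left_mono nn)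
    fix i j
    show "e i * v $ i * (e j * v $ j) \<le> ((e i * v $ i)\<^sup>2 + (e j * v $ j)\<^sup>2) / 2"
      using sum_squares_bound[of "e i * v $ i" "e j * v $ j"] by simp
  qed
  also have "\<dots> = (\<Sum>i\<in>UNIV. \<Sum>j\<in>UNIV. Adj $ i $ j * (e i * v $ i)\<^sup>2) / 2
      + (\<Sum>i\<in>UNIV. \<Sum>j\<in>UNIV. Adj $ i $ j * (e j * v $ j)\<^sup>2) / 2"
    by (simp add: sum.distrib distrib_left add_divide_distrib sum_divide_distrib)
  also have "(\<Sum>i\<in>UNIV. \<Sum>j\<in>UNIV. Adj $ i $ j * (e j * v $ j)\<^sup>2)
      = (\<Sum>i\<in>UNIV. \<Sum>j\<in>UNIV. Adj $ i $ j * (e i * v $ i)\<^sup>2)"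
    by (subst sum.swap) (simp add: sym')
  finally have "v \<bullet> ((diag_matrix e ** Adj ** diag_matrix e) *v v) \<le> v \<bullet> v"
    using diag_le by simp
  then show ?thesis
    by (simp add: norm_laplacian_def Let_def matrix_vector_mult_diff_rdistrib inner_diff_right
        e_def[abs_def])
qed

text \<open>\<open>d i\<close> is the value of the quadratic form at the i-th column of
  \<open>U\<close>. It applies to \<open>lam\<close>, which is known only through the decomposition
  of \<open>L\<close>.\<close>

lemma conjugate_diag_eigenvalue_nonneg:
  fixes U :: "real^'n^'n"
  assumes U: "transpose U ** U = mat 1" and nn: "\<And>v. 0 \<le> v \<bullet> ((U ** diag_matrix d ** transpose U) *v v)"
  shows "0 \<le> d i"
proof -
  define v where "v = U *v axis i 1"
  have v: "transpose U *v v = axis i 1"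
    by (simp add: v_def matrix_vector_mul_assoc U)
  have "v \<bullet> ((U ** diag_matrix d ** transpose U) *v v)
      = (transpose U *v v) \<bullet> (diag_matrix d *v (transpose U *v v))"
    by (simp add: dot_lmul_matrix vector_transpose_matrix flip: matrix_vector_mul_assoc)
  also have "\<dots> = d i"
    unfolding v by (simp add: inner_axis' diag_matrix_mult_vec)
  finally show ?thesis using nn[of v] by simp
qed

section \<open>Linear operations and coordinates in the eigenbasis\<close>

lemma matrix_mult_add_left:
  fixes A B :: "'a::semiring_1^'n^'m" and C :: "'a^'k^'n"
  shows "(A + B) ** C = A ** C + B ** C"
  by (simp add: matrix_matrix_mult_def vec_eq_iff distrib_right sum.distrib)

lemma conjugate_diag_add:
  fixes U :: "real^'n^'n"
  shows "U ** diag_matrix d ** transpose U + U ** diag_matrix e ** transpose U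
    = U ** diag_matrix (\<lambda>i. d i + e i) ** transpose U"
proof -
  have "diag_matrix (\<lambda>i. d i + e i) = diag_matrix d + diag_matrix e"
    by (simp add: diag_matrix_def vec_eq_iff)
  then show ?thesis
    by (simp add: matrix_add_ldistrib[of U] matrix_mult_add_left)
qed

lemma conjugate_diag_scale:
  fixes U :: "real^'n^'n"
  shows "r *\<^sub>R (U ** diag_matrix d ** transpose U) = U ** diag_matrix (\<lambda>i. r * d i) ** transpose U"
proof -
  have "diag_matrix (\<lambda>i. r * d i) = r *\<^sub>R diag_matrix d"
    by (simp add: diag_matrix_def vec_eq_iff)
  then show ?thesis
    by (simp add: matrix_scalar_ac scalar_matrix_assoc)
qed

lemma transpose_conjugate_diag_mult_vec:
  fixes U :: "real^'n^'n"
  assumes "transpose U ** U = mat 1"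
  shows "(transpose U *v ((U ** diag_matrix d ** transpose U) *v w)) $ i = d i * (transpose U *v w) $ i"
proof -
  have "transpose U *v ((U ** diag_matrix d ** transpose U) *v w)
    = (transpose U ** U) *v (diag_matrix d *v (transpose U *v w))"
    by (simp only: matrix_vector_mul_assoc matrix_mul_assoc)
  then show ?thesis
    by (simp only: assms matrix_vector_mul_lid diag_matrix_mult_vec)
qed

text \<open>Turns a graph-Fourier coefficient into an inner product with a unit vector, the form in
  which Brownian motion and vector Ito integrals are projected later.\<close>

lemma transpose_mult_vec_component:
  fixes U :: "real^'n^'m"
  shows "(transpose U *v w) $ i = column i U \<bullet> w"
  by (simp add: matrix_vector_mult_def transpose_def column_def inner_vec_def)

lemma norm_column_orthogonal:
  fixes U :: "real^'n^'n"
  assumes "transpose U ** U = mat 1"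
  shows "norm (column i U) = 1"
proof -
  have "(transpose U ** U) $ i $ i = column i U \<bullet> column i U"
    by (simp add: matrix_matrix_mult_def transpose_def column_def inner_vec_def)
  then show ?thesis
    using assms by (simp add: norm_eq_sqrt_inner mat_def)
qed

section \<open>Brownian motion\<close>

lemma rv_events_eq: "rv_events M X = {X -` A \<inter> space M |A. A \<in> sets borel}"
  unfolding rv_events_def by (simp add: sets_vimage_algebra2)

lemma rv_events_compose_subset:
  assumes "f \<in> borel_measurable borel"
  shows "rv_events M (\<lambda>\<omega>. f (X \<omega>)) \<subseteq> rv_events M X"
proof
  fix B assume "B \<in> rv_events M (\<lambda>\<omega>. f (X \<omega>))"
  then obtain A where A: "A \<in> sets borel" "B = (\<lambda>\<omega>. f (X \<omega>)) -` A \<inter> space M"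
    by (auto simp: rv_events_eq)
  have "f -` A \<in> sets borel"
    using measurable_sets[OF assms A(1)] by simp
  then show "B \<in> rv_events M X"
    using A(2) by (auto simp: rv_events_eq intro!: exI[of _ "f -` A"])
qed

lemma (in prob_space) indep_set_mono:
  assumes "indep_set A B" "A' \<subseteq> A" "B' \<subseteq> B"
  shows "indep_set A' B'"
  using assms unfolding indep_set_def by (rule_tac indep_sets_mono_sets) (auto split: bool.split)

text \<open>For a real-valued process \<open>Basis\<close> is a singleton, so the clause of
  \<open>brownian_motion\<close> on independent components reduces to measurability.\<close>

lemma (in prob_space) indep_vars_singleton:
  assumes "X i \<in> measurable M (N i)"
  shows "indep_vars N X {i}"
  unfolding indep_vars_def2 indep_sets_def using assms
  by (auto simp: subset_singleton_iff prob_space intro: measurable_sets)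

text \<open>Passes from independence of families of events, as in \<open>brownian_motion\<close>, to
  independence of random variables, for which expectations of products factorise.\<close>

lemma (in prob_space) indep_var_borelI:
  fixes Y Z :: "'a \<Rightarrow> 'b::topological_space"
  assumes ind: "indep_set (sets G) (rv_events M Z)"
    and Y: "Y \<in> borel_measurable G" and Z: "Z \<in> borel_measurable M" and sub: "subalgebra M G"
  shows "indep_var borel Y borel Z"
  unfolding indep_var_eq
proof (intro conjI)
  show "random_variable borel Y"
    using Y sub by (rule measurable_from_subalg[rotated])
  have sp: "space G = space M" using sub by (simp add: subalgebra_def)
  have "sigma_sets (space M) {Y -` A \<inter> space M |A. A \<in> sets borel} \<subseteq> sets G"
    unfolding sp[symmetric] by (rule sets.sigma_sets_subset) (auto intro: measurable_sets[OF Y])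
  moreover have "sigma_sets (space M) {Z -` A \<inter> space M |A. A \<in> sets borel} = rv_events M Z"
    unfolding rv_events_def by (simp add: sets_vimage_algebra)
  ultimately show "indep_set (sigma_sets (space M) {Y -` A \<inter> space M |A. A \<in> sets borel})
      (sigma_sets (space M) {Z -` A \<inter> space M |A. A \<in> sets borel})"
    using ind by (simp add: indep_set_mono)
qed (fact Z)

lemma (in prob_space) unit_combination_normal:
  fixes u :: "'i \<Rightarrow> real"
  assumes I: "finite I" and ind: "indep_vars (\<lambda>_. borel) X I"
    and normal: "\<And>i. i \<in> I \<Longrightarrow> distributed M lborel (X i) (normal_density 0 s)"
    and s: "0 < s" and u: "(\<Sum>i\<in>I. (u i)\<^sup>2) = 1"
  shows "distributed M lborel (\<lambda>\<omega>. \<Sum>i\<in>I. u i * X i \<omega>) (normal_density 0 s)"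
proof -
  \<comment> \<open>A term with zero coefficient is not normal with positive variance, so
    \<open>sum_indep_normal\<close> is applied to the remaining indices only; there is at least one,
    because the squares of the coefficients sum to 1.\<close>
  define J where "J = {i\<in>I. u i \<noteq> 0}"
  have J: "finite J" "J \<subseteq> I" using I by (auto simp: J_def)
  have sum_J: "(\<Sum>i\<in>J. f i) = (\<Sum>i\<in>I. f i)" if "\<And>i. u i = 0 \<Longrightarrow> f i = 0" for f :: "'i \<Rightarrow> real"
    using I that by (intro sum.mono_neutral_left) (auto simp: J_def)
  have "distributed M lborel (\<lambda>\<omega>. \<Sum>i\<in>J. u i * X i \<omega>)
      (normal_density (\<Sum>i\<in>J. 0) (sqrt (\<Sum>i\<in>J. (\<bar>u i\<bar> * s)\<^sup>2)))"
  proof (rule sum_indep_normal)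
    show "J \<noteq> {}" using u sum_J[of "\<lambda>i. (u i)\<^sup>2"] by auto
    show "indep_vars (\<lambda>_. borel) (\<lambda>i \<omega>. u i * X i \<omega>) J"
      by (rule indep_vars_compose2[OF indep_vars_subset[OF ind J(2)], of "\<lambda>i x. u i * x"]) simp
    fix i assume i: "i \<in> J"
    then show "0 < \<bar>u i\<bar> * s" using s by (simp add: J_def)
    show "distributed M lborel (\<lambda>\<omega>. u i * X i \<omega>) (normal_density 0 (\<bar>u i\<bar> * s))"
      using normal_density_affine[of "X i" 0 s "u i" 0] normal[of i] i s by (simp add: J_def)
  qed (fact J)
  also have "sqrt (\<Sum>i\<in>J. (\<bar>u i\<bar> * s)\<^sup>2) = s"
    using sum_J[of "\<lambda>i. (u i)\<^sup>2"] u s by (simp add: power_mult_distrib flip: sum_distrib_right)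
  also have "(\<lambda>\<omega>. \<Sum>i\<in>J. u i * X i \<omega>) = (\<lambda>\<omega>. \<Sum>i\<in>I. u i * X i \<omega>)"
    by (intro ext sum_J) simp
  finally show ?thesis by simp
qed

text \<open>Events of the projected increment are events of the vector increment, so independence of
  the past is inherited for the same \<open>F\<close>. The projected increment is a unit combination
  of independent centred normals of equal variance, hence normal with that variance.\<close>

lemma brownian_motion_inner:
  fixes W :: "real \<Rightarrow> 'a \<Rightarrow> 'b::euclidean_space"
  assumes P: "prob_space M" and W: "brownian_motion M F W" and u: "norm u = 1"
  shows "brownian_motion M F (\<lambda>t \<omega>. u \<bullet> W t \<omega>)"
proof -
  interpret prob_space M by fact
  have sub: "subalgebra M (F t)" for t
    using W by (simp add: brownian_motion_def)
  have meas: "W t \<in> borel_measurable (F t)" if "0 \<le> t" for t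
    using W that by (simp add: brownian_motion_def)
  have measM: "W t \<in> borel_measurable M" if "0 \<le> t" for t
    using meas[OF that] sub by (rule measurable_from_subalg[rotated])
  have comb: "u \<bullet> W t \<omega> - u \<bullet> W s \<omega> = (\<Sum>b\<in>Basis. (u \<bullet> b) * ((W t \<omega> - W s \<omega>) \<bullet> b))" for s t \<omega>
    by (simp add: euclidean_inner[of u "W t \<omega> - W s \<omega>"] flip: inner_diff_right)
  show ?thesis
    unfolding brownian_motion_def
  proof (intro conjI allI impI)
    show "AE \<omega> in M. u \<bullet> W 0 \<omega> = 0"
      using W by (auto simp: brownian_motion_def)
    show "AE \<omega> in M. continuous_on {0..} (\<lambda>t. u \<bullet> W t \<omega>)"
    proof (rule AE_mp)
      show "AE \<omega> in M. continuous_on {0..} (\<lambda>t. W t \<omega>)"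
        using W by (simp add: brownian_motion_def)
    qed (auto intro!: AE_I2 continuous_on_inner)
    fix s t :: real assume "0 \<le> s \<and> s < t"
    then have st: "0 \<le> s" "s < t" by auto
    have "indep_set (sets (F s)) (rv_events M (\<lambda>\<omega>. W t \<omega> - W s \<omega>))"
      using W st by (simp add: brownian_motion_def)
    then show "indep_set (sets (F s)) (rv_events M (\<lambda>\<omega>. u \<bullet> W t \<omega> - u \<bullet> W s \<omega>))"
      unfolding inner_diff_right[symmetric]
      by (rule indep_set_mono) (auto intro: rv_events_compose_subset[THEN subsetD, rotated])
    show "indep_vars (\<lambda>_. borel) (\<lambda>b \<omega>. (u \<bullet> W t \<omega> - u \<bullet> W s \<omega>) \<bullet> b) (Basis :: real set)"
      unfolding Basis_real_def using measM st by (intro indep_vars_singleton) simp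
    have "distributed M lborel (\<lambda>\<omega>. \<Sum>b\<in>Basis. (u \<bullet> b) * ((W t \<omega> - W s \<omega>) \<bullet> b))
        (normal_density 0 (sqrt (t - s)))"
    proof (rule unit_combination_normal)
      have "(\<Sum>b\<in>Basis. (u \<bullet> b)\<^sup>2) = (norm u)\<^sup>2"
        unfolding power2_norm_eq_inner euclidean_inner[of u u] by (simp add: power2_eq_square)
      with u show "(\<Sum>b\<in>Basis. (u \<bullet> b)\<^sup>2) = 1" by simp
    qed (use W st in \<open>auto simp: brownian_motion_def\<close>)
    then show "\<forall>b\<in>Basis. distributed M lborel (\<lambda>\<omega>. (u \<bullet> W t \<omega> - u \<bullet> W s \<omega>) \<bullet> b)
        (\<lambda>x. ennreal (normal_density 0 (sqrt (t - s)) x))"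
      by (simp add: comb)
  qed (use W meas in \<open>auto simp: brownian_motion_def\<close>)
qed

section \<open>Moments of scalar Brownian increments\<close>

locale real_brownian_motion = prob_space M
  for M :: "'a measure" +
  fixes F :: "real \<Rightarrow> 'a measure" and B :: "real \<Rightarrow> 'a \<Rightarrow> real"
  assumes bm: "brownian_motion M F B"
begin

lemma subalg: "subalgebra M (F t)"
  using bm by (simp add: brownian_motion_def)

lemma filtration_mono: "s \<le> t \<Longrightarrow> f \<in> borel_measurable (F s) \<Longrightarrow> f \<in> borel_measurable (F t)"
  using bm filtration.sets_F_mono[of "space M" F s t] filtration.space_F[of "space M" F]
  by (auto simp: brownian_motion_def intro!: measurable_from_subalg[of "F t" "F s"] simp: subalgebra_def)

lemma adapted: "0 \<le> s \<Longrightarrow> s \<le> t \<Longrightarrow> B s \<in> borel_measurable (F t)"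
  using bm by (intro filtration_mono[of s t]) (auto simp: brownian_motion_def)

lemma measurable_M: "f \<in> borel_measurable (F t) \<Longrightarrow> f \<in> borel_measurable M"
  by (rule measurable_from_subalg[OF subalg])

lemma B_measurable: "0 \<le> t \<Longrightarrow> B t \<in> borel_measurable M"
  using adapted[of t t] by (simp add: measurable_M)

lemma increment_moments:
  assumes st: "0 \<le> s" "s \<le> t"
  shows "integrable M (\<lambda>\<omega>. B t \<omega> - B s \<omega>)" and "expectation (\<lambda>\<omega>. B t \<omega> - B s \<omega>) = 0"
    and "integrable M (\<lambda>\<omega>. (B t \<omega> - B s \<omega>)\<^sup>2)" and "expectation (\<lambda>\<omega>. (B t \<omega> - B s \<omega>)\<^sup>2) = t - s"
proof -
  have "integrable M (\<lambda>\<omega>. B t \<omega> - B s \<omega>) \<and> expectation (\<lambda>\<omega>. B t \<omega> - B s \<omega>) = 0 \<and>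
     integrable M (\<lambda>\<omega>. (B t \<omega> - B s \<omega>)\<^sup>2) \<and> expectation (\<lambda>\<omega>. (B t \<omega> - B s \<omega>)\<^sup>2) = t - s"
  \<comment> \<open>The law of an increment is prescribed only for \<open>s < t\<close>; at
    \<open>s = t\<close> the increment is identically 0.\<close>
  proof (cases "s = t")
    case False
    with st have s: "0 < sqrt (t - s)" by simp
    have D: "distributed M lborel (\<lambda>\<omega>. B t \<omega> - B s \<omega>) (normal_density 0 (sqrt (t - s)))"
      using bm st False by (simp add: brownian_motion_def)
    note [simp] = normal_distributed_expectation[OF s D]
    have "expectation (\<lambda>\<omega>. (B t \<omega> - B s \<omega>)\<^sup>2) = t - s"
      using normal_distributed_variance[OF s D] s by simp
    moreover have "integrable M (\<lambda>\<omega>. (B t \<omega> - B s \<omega>)^k)" for k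
      using distributed_integrable[OF D, of "\<lambda>x. x^k"] integrable_normal_moment[OF s, of 0 k] by simp
    from this[of 1] this[of 2] have "integrable M (\<lambda>\<omega>. B t \<omega> - B s \<omega>)" "integrable M (\<lambda>\<omega>. (B t \<omega> - B s \<omega>)\<^sup>2)"
      by auto
    ultimately show ?thesis
      by simp
  qed simp
  then show "integrable M (\<lambda>\<omega>. B t \<omega> - B s \<omega>)"
    and "expectation (\<lambda>\<omega>. B t \<omega> - B s \<omega>) = 0"
    and "integrable M (\<lambda>\<omega>. (B t \<omega> - B s \<omega>)\<^sup>2)"
    and "expectation (\<lambda>\<omega>. (B t \<omega> - B s \<omega>)\<^sup>2) = t - s"
    by auto
qed

text \<open>Independence of the increment from \<open>F s\<close> splits off the factor
  \<open>Y\<close>. The vanishing mean removes the cross terms of the isometry, the second moment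
  supplies its diagonal terms.\<close>

lemma past_increment_moments:
  assumes st: "0 \<le> s" "s \<le> t" and Y: "Y \<in> borel_measurable (F s)" "integrable M Y"
  shows "integrable M (\<lambda>\<omega>. Y \<omega> * (B t \<omega> - B s \<omega>))" and "expectation (\<lambda>\<omega>. Y \<omega> * (B t \<omega> - B s \<omega>)) = 0"
    and "integrable M (\<lambda>\<omega>. Y \<omega> * (B t \<omega> - B s \<omega>)\<^sup>2)"
    and "expectation (\<lambda>\<omega>. Y \<omega> * (B t \<omega> - B s \<omega>)\<^sup>2) = expectation Y * (t - s)"
proof -
  have "integrable M (\<lambda>\<omega>. Y \<omega> * (B t \<omega> - B s \<omega>)) \<and> expectation (\<lambda>\<omega>. Y \<omega> * (B t \<omega> - B s \<omega>)) = 0 \<and>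
     integrable M (\<lambda>\<omega>. Y \<omega> * (B t \<omega> - B s \<omega>)\<^sup>2) \<and>
     expectation (\<lambda>\<omega>. Y \<omega> * (B t \<omega> - B s \<omega>)\<^sup>2) = expectation Y * (t - s)"
  proof (cases "s = t")
    case False
    with st have "s < t" by simp
    then have ind: "indep_var borel Y borel (\<lambda>\<omega>. B t \<omega> - B s \<omega>)"
      using bm st Y B_measurable by (intro indep_var_borelI[OF _ Y(1) _ subalg]) (auto simp: brownian_motion_def)
    have ind2: "indep_var borel Y borel (\<lambda>\<omega>. (B t \<omega> - B s \<omega>)\<^sup>2)"
      using indep_var_compose[OF ind, of "\<lambda>y. y" borel "\<lambda>x. x\<^sup>2" borel] by (simp add: comp_def)
    note m = increment_moments[OF st]
    show ?thesis
      using indep_var_integrable[OF ind Y(2) m(1)] indep_var_lebesgue_integral[OF ind Y(2) m(1)]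
        indep_var_integrable[OF ind2 Y(2) m(3)] indep_var_lebesgue_integral[OF ind2 Y(2) m(3)]
      by (simp add: m(2,4))
  qed simp
  then show "integrable M (\<lambda>\<omega>. Y \<omega> * (B t \<omega> - B s \<omega>))"
    and "expectation (\<lambda>\<omega>. Y \<omega> * (B t \<omega> - B s \<omega>)) = 0"
    and "integrable M (\<lambda>\<omega>. Y \<omega> * (B t \<omega> - B s \<omega>)\<^sup>2)"
    and "expectation (\<lambda>\<omega>. Y \<omega> * (B t \<omega> - B s \<omega>)\<^sup>2) = expectation Y * (t - s)"
    by auto
qed

end

section \<open>The Ito isometry\<close>

lemma (in pair_sigma_finite) tensor_product:
  fixes f :: "'a \<Rightarrow> real" and g :: "'b \<Rightarrow> real"
  assumes f: "integrable M1 f" and g: "integrable M2 g"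
  shows integrable_tensor_product: "integrable (M1 \<Otimes>\<^sub>M M2) (\<lambda>(x, y). f x * g y)"
    and integral_tensor_product: "integral\<^sup>L (M1 \<Otimes>\<^sub>M M2) (\<lambda>(x, y). f x * g y) = integral\<^sup>L M1 f * integral\<^sup>L M2 g"
proof -
  show *: "integrable (M1 \<Otimes>\<^sub>M M2) (\<lambda>(x, y). f x * g y)"
    using f g by (intro Fubini_integrable) (auto simp: abs_mult)
  show "integral\<^sup>L (M1 \<Otimes>\<^sub>M M2) (\<lambda>(x, y). f x * g y) = integral\<^sup>L M1 f * integral\<^sup>L M2 g"
    using integral_fst'[OF *] by simp
qed

lemma integrable_bounded_mult:
  fixes f g :: "'a \<Rightarrow> real"
  assumes "integrable M f" and "g \<in> borel_measurable M" and "\<forall>\<omega>\<in>space M. \<bar>g \<omega>\<bar> \<le> C"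
  shows "integrable M (\<lambda>\<omega>. g \<omega> * f \<omega>)"
proof (rule Bochner_Integration.integrable_bound)
  show "integrable M (\<lambda>\<omega>. C * f \<omega>)" using assms(1) by simp
  show "AE \<omega> in M. norm (g \<omega> * f \<omega>) \<le> norm (C * f \<omega>)"
  proof (rule AE_I2)
    fix \<omega> assume "\<omega> \<in> space M"
    then have "\<bar>g \<omega>\<bar> \<le> \<bar>C\<bar>" using assms(3) by fastforce
    then show "norm (g \<omega> * f \<omega>) \<le> norm (C * f \<omega>)"
      by (simp add: abs_mult mult_right_mono)
  qed
qed (use assms in simp)

context real_brownian_motion
begin

sublocale MN: pair_sigma_finite M lborel ..

abbreviation "N \<equiv> M \<Otimes>\<^sub>M (lborel :: real measure)"

text \<open>Cut both intervals at \<open>s'\<close> and at the earlier right end. Every product of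
  increments over successive disjoint intervals has mean zero given the past, and only the square of
  the increment over the common part survives; \<open>max 0 (min t t' - s')\<close> is the length of
  that part.\<close>

lemma expectation_overlap:
  assumes t: "0 \<le> s" "s \<le> t" "s' \<le> t'" "s \<le> s'"
    and \<xi>: "\<xi> \<in> borel_measurable (F s)" "\<forall>\<omega>\<in>space M. \<bar>\<xi> \<omega>\<bar> \<le> C"
    and \<eta>: "\<eta> \<in> borel_measurable (F s')" "\<forall>\<omega>\<in>space M. \<bar>\<eta> \<omega>\<bar> \<le> C'"
  shows "integrable M (\<lambda>\<omega>. (\<xi> \<omega> * (B t \<omega> - B s \<omega>)) * (\<eta> \<omega> * (B t' \<omega> - B s' \<omega>)))"
    and "expectation (\<lambda>\<omega>. (\<xi> \<omega> * (B t \<omega> - B s \<omega>)) * (\<eta> \<omega> * (B t' \<omega> - B s' \<omega>)))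
      = expectation (\<lambda>\<omega>. \<xi> \<omega> * \<eta> \<omega>) * max 0 (min t t' - s')"
proof -
  define Y where "Y \<omega> = \<xi> \<omega> * \<eta> \<omega>" for \<omega>
  have YF: "Y \<in> borel_measurable (F r)" if "s' \<le> r" for r
    unfolding Y_def using that t \<xi> \<eta>
    by (intro borel_measurable_times filtration_mono[of s r] filtration_mono[of s' r]) auto
  have YM: "Y \<in> borel_measurable M"
    using YF[of s'] measurable_M by simp
  have Yb: "\<forall>\<omega>\<in>space M. \<bar>Y \<omega>\<bar> \<le> C * C'"
  proof
    fix \<omega> assume "\<omega> \<in> space M"
    then have "\<bar>\<xi> \<omega>\<bar> \<le> C" "\<bar>\<eta> \<omega>\<bar> \<le> C'" using \<xi> \<eta> by auto
    then show "\<bar>Y \<omega>\<bar> \<le> C * C'"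
      unfolding Y_def abs_mult by (intro mult_mono) auto
  qed
  have Yi: "integrable M Y"
    using YM Yb by (intro integrable_const_bound[where B="C * C'"]) auto
  have YB: "integrable M (\<lambda>\<omega>. Y \<omega> * (B b \<omega> - B a \<omega>))" if "0 \<le> a" "a \<le> b" for a b
    using integrable_bounded_mult[OF increment_moments(1)[OF that] YM Yb] .
  have YBF: "(\<lambda>\<omega>. Y \<omega> * (B b \<omega> - B a \<omega>)) \<in> borel_measurable (F r)"
    if "0 \<le> a" "a \<le> b" "b \<le> r" "s' \<le> r" for a b r
    using that YF[of r] adapted[of a r] adapted[of b r] by simp
  \<comment> \<open>Only the later increment has to lie after \<open>s'\<close>: the product of
    \<open>Y\<close> with the earlier one must be known at time \<open>c\<close>, so
    \<open>a\<close> may precede \<open>s'\<close>.\<close>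
  have orth: "integrable M (\<lambda>\<omega>. Y \<omega> * (B b \<omega> - B a \<omega>) * (B d \<omega> - B c \<omega>)) \<and>
      expectation (\<lambda>\<omega>. Y \<omega> * (B b \<omega> - B a \<omega>) * (B d \<omega> - B c \<omega>)) = 0"
    if "0 \<le> a" "a \<le> b" "b \<le> c" "c \<le> d" "s' \<le> c" for a b c d
    using past_increment_moments(1,2)[OF _ that(4) YBF[OF that(1-3,5)] YB[OF that(1,2)]] that by simp
  have sq: "integrable M (\<lambda>\<omega>. Y \<omega> * (B b \<omega> - B s' \<omega>)\<^sup>2) \<and>
      expectation (\<lambda>\<omega>. Y \<omega> * (B b \<omega> - B s' \<omega>)\<^sup>2) = expectation Y * (b - s')" if "s' \<le> b" for b
    using past_increment_moments(3,4)[OF _ that YF[OF order_refl] Yi] t by simp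
  define m where "m = min t t'"
  have "integrable M (\<lambda>\<omega>. (\<xi> \<omega> * (B t \<omega> - B s \<omega>)) * (\<eta> \<omega> * (B t' \<omega> - B s' \<omega>))) \<and>
     expectation (\<lambda>\<omega>. (\<xi> \<omega> * (B t \<omega> - B s \<omega>)) * (\<eta> \<omega> * (B t' \<omega> - B s' \<omega>)))
      = expectation Y * max 0 (min t t' - s')"
  proof (cases "t \<le> s'")
    case True
    have eq: "(\<lambda>\<omega>. (\<xi> \<omega> * (B t \<omega> - B s \<omega>)) * (\<eta> \<omega> * (B t' \<omega> - B s' \<omega>)))
      = (\<lambda>\<omega>. Y \<omega> * (B t \<omega> - B s \<omega>) * (B t' \<omega> - B s' \<omega>))"
      by (auto simp: Y_def)
    show ?thesis
      unfolding eq using orth[of s t s' t'] t True by simp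
  next
    case False
    \<comment> \<open>The expansion would also contain \<open>Y \<omega> * (B t \<omega> - B m
      \<omega>) * (B t' \<omega> - B m \<omega>)\<close>, which is 0 because \<open>m\<close> is one
      of \<open>t\<close> and \<open>t'\<close>.\<close>
    have eq: "(\<xi> \<omega> * (B t \<omega> - B s \<omega>)) * (\<eta> \<omega> * (B t' \<omega> - B s' \<omega>))
      = Y \<omega> * (B s' \<omega> - B s \<omega>) * (B t' \<omega> - B s' \<omega>) + Y \<omega> * (B m \<omega> - B s' \<omega>)\<^sup>2
        + Y \<omega> * (B m \<omega> - B s' \<omega>) * (B t \<omega> - B m \<omega>) + Y \<omega> * (B m \<omega> - B s' \<omega>) * (B t' \<omega> - B m \<omega>)" for \<omega>
      by (cases "t \<le> t'") (simp_all add: m_def Y_def algebra_simps power2_eq_square)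
    have m: "s' \<le> m" "m \<le> t" "m \<le> t'" "0 \<le> s'"
      using False t by (auto simp: m_def)
    note o1 = orth[of s s' s' t'] and o2 = orth[of s' m m t] and o3 = orth[of s' m m t'] and o4 = sq[of m]
    show ?thesis
      unfolding eq using o1 o2 o3 o4 m t by (simp add: m_def)
  qed
  then show "integrable M (\<lambda>\<omega>. (\<xi> \<omega> * (B t \<omega> - B s \<omega>)) * (\<eta> \<omega> * (B t' \<omega> - B s' \<omega>)))"
    and "expectation (\<lambda>\<omega>. (\<xi> \<omega> * (B t \<omega> - B s \<omega>)) * (\<eta> \<omega> * (B t' \<omega> - B s' \<omega>)))
      = expectation (\<lambda>\<omega>. \<xi> \<omega> * \<eta> \<omega>) * max 0 (min t t' - s')"
    by (auto simp: Y_def[abs_def])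
qed

text \<open>A simple integrand together with its integral. The time intervals need not be disjoint, so
  that sums of integrands on different partitions need no common refinement.\<close>

inductive simple_pair :: "('a \<times> real \<Rightarrow> real) \<Rightarrow> ('a \<Rightarrow> real) \<Rightarrow> bool" where
  step: "\<lbrakk>0 \<le> s; s \<le> t; \<xi> \<in> borel_measurable (F s); \<forall>\<omega>\<in>space M. \<bar>\<xi> \<omega>\<bar> \<le> C\<rbrakk> \<Longrightarrow>
    simple_pair (\<lambda>(\<omega>, u). \<xi> \<omega> * indicator {s<..t} u) (\<lambda>\<omega>. \<xi> \<omega> * (B t \<omega> - B s \<omega>))"
| add: "\<lbrakk>simple_pair V S; simple_pair V' S'\<rbrakk> \<Longrightarrow> simple_pair (\<lambda>z. V z + V' z) (\<lambda>\<omega>. S \<omega> + S' \<omega>)"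

lemma simple_pair_zero: "simple_pair (\<lambda>_. 0) (\<lambda>_. 0)"
  using step[of 0 0 "\<lambda>_. 0" 0] by (simp add: case_prod_unfold)

lemma simple_pair_scale: "simple_pair V S \<Longrightarrow> simple_pair (\<lambda>z. a * V z) (\<lambda>\<omega>. a * S \<omega>)"
proof (induction rule: simple_pair.induct)
  case (step s t \<xi> C)
  have "simple_pair (\<lambda>(\<omega>, u). (a * \<xi> \<omega>) * indicator {s<..t} u) (\<lambda>\<omega>. (a * \<xi> \<omega>) * (B t \<omega> - B s \<omega>))"
    using step by (intro simple_pair.step[where C="\<bar>a\<bar> * C"]) (auto simp: abs_mult mult_left_mono)
  then show ?case by (simp add: case_prod_unfold mult.assoc)
next
  case (add V S V' S')
  then show ?case by (simp add: distrib_left simple_pair.add)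
qed

lemma simple_pair_sum:
  assumes "\<And>k. k \<in> K \<Longrightarrow> simple_pair (V k) (S k)"
  shows "simple_pair (\<lambda>z. \<Sum>k\<in>K. V k z) (\<lambda>\<omega>. \<Sum>k\<in>K. S k \<omega>)"
  using assms by (induction K rule: infinite_finite_induct) (auto intro: simple_pair_zero simple_pair.add)

lemma simple_pair_measurable:
  "simple_pair V S \<Longrightarrow> V \<in> borel_measurable N \<and> S \<in> borel_measurable M"
proof (induction rule: simple_pair.induct)
  case (step s t \<xi> C)
  have "\<xi> \<in> borel_measurable M" using step measurable_M by blast
  with step B_measurable[of s] B_measurable[of t] show ?case by auto
qed auto

text \<open>The isometry is proved in polarised form, because a statement about squares would not
  survive the rule \<open>add\<close>, while a bilinear one can be inducted on in each argument.
  Here the left argument is a single step.\<close>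

lemma simple_pair_isometry_step:
  assumes s: "0 \<le> s" "s \<le> t" "\<xi> \<in> borel_measurable (F s)" "\<forall>\<omega>\<in>space M. \<bar>\<xi> \<omega>\<bar> \<le> C"
    and V: "simple_pair V S"
  shows "integrable M (\<lambda>\<omega>. (\<xi> \<omega> * (B t \<omega> - B s \<omega>)) * S \<omega>) \<and>
    integrable N (\<lambda>z. (case z of (\<omega>, u) \<Rightarrow> \<xi> \<omega> * indicator {s<..t} u) * V z) \<and>
    expectation (\<lambda>\<omega>. (\<xi> \<omega> * (B t \<omega> - B s \<omega>)) * S \<omega>)
      = (\<integral>z. (case z of (\<omega>, u) \<Rightarrow> \<xi> \<omega> * indicator {s<..t} u) * V z \<partial>N)"
  using V
proof (induction rule: simple_pair.induct)
  case (step s' t' \<eta> C')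
  have meas: "\<xi> \<in> borel_measurable M" "\<eta> \<in> borel_measurable M"
    using s step measurable_M by blast+
  have i: "integrable M (\<lambda>\<omega>. \<xi> \<omega> * \<eta> \<omega>)"
    using integrable_bounded_mult[OF integrable_const_bound[of \<eta> C'] meas(1) s(4)] meas step by auto
  have E: "integrable M (\<lambda>\<omega>. (\<xi> \<omega> * (B t \<omega> - B s \<omega>)) * (\<eta> \<omega> * (B t' \<omega> - B s' \<omega>))) \<and>
      expectation (\<lambda>\<omega>. (\<xi> \<omega> * (B t \<omega> - B s \<omega>)) * (\<eta> \<omega> * (B t' \<omega> - B s' \<omega>)))
      = expectation (\<lambda>\<omega>. \<xi> \<omega> * \<eta> \<omega>) * max 0 (min t t' - max s s')"
  proof (cases "s \<le> s'")
    case True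
    with expectation_overlap[OF s(1,2) step(2) True s(3,4) step(3,4)] show ?thesis
      by (simp add: max_absorb2)
  next
    case False
    with expectation_overlap[OF step(1,2) s(2) _ step(3,4) s(3,4)] show ?thesis
      by (simp add: max_absorb1 mult.commute min.commute)
  qed
  have eq: "(\<lambda>z. (case z of (\<omega>, u) \<Rightarrow> \<xi> \<omega> * indicator {s<..t} u) * (case z of (\<omega>, u) \<Rightarrow> \<eta> \<omega> * indicator {s'<..t'} u))
    = (\<lambda>(\<omega>, u). (\<xi> \<omega> * \<eta> \<omega>) * indicator {max s s'<..min t t'} u)"
    by (auto simp: indicator_def)
  \<comment> \<open>Includes disjoint time intervals: the intersection is then empty and both sides
    are 0.\<close>
  have "emeasure lborel {a<..b} < \<infinity> \<and> measure lborel {a<..b} = max 0 (b - a)" for a b :: real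
    by (cases "a \<le> b") auto
  note Ioc = this[of "max s s'" "min t t'"]
  have "integrable lborel (indicator {max s s'<..min t t'} :: real \<Rightarrow> real)"
    using Ioc by (intro integrable_real_indicator) auto
  note T = MN.tensor_product[OF i this]
  have "integral\<^sup>L lborel (indicator {max s s'<..min t t'} :: real \<Rightarrow> real) = max 0 (min t t' - max s s')"
    by (simp add: Ioc)
  with T E show ?case unfolding eq by simp
next
  case (add V S V' S')
  then show ?case by (simp add: distrib_left)
qed

lemma simple_pair_isometry:
  assumes "simple_pair V S" "simple_pair V' S'"
  shows "integrable M (\<lambda>\<omega>. S \<omega> * S' \<omega>) \<and> integrable N (\<lambda>z. V z * V' z) \<and>
    expectation (\<lambda>\<omega>. S \<omega> * S' \<omega>) = (\<integral>z. V z * V' z \<partial>N)"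
  using assms(1)
proof (induction rule: simple_pair.induct)
  case (step s t \<xi> C)
  then show ?case using simple_pair_isometry_step[OF _ _ _ _ assms(2)] by blast
next
  case (add V1 S1 V2 S2)
  then show ?case by (simp add: distrib_right)
qed

lemma simple_pair_nn_isometry:
  assumes "simple_pair V S"
  shows "(\<integral>\<^sup>+\<omega>. ennreal ((S \<omega>)\<^sup>2) \<partial>M) = (\<integral>\<^sup>+z. ennreal ((V z)\<^sup>2) \<partial>N)"
  using simple_pair_isometry[OF assms assms]
  by (simp add: nn_integral_eq_integral flip: power2_eq_square)

end

section \<open>Integrals of deterministic integrands\<close>

text \<open>Replaces the triangle inequality of L2. In extended nonnegative numbers it can be used
  without first showing that any of the integrals is finite; it is the source of the constants 2, 4
  and 8 below.\<close>

lemma nn_integral_square_add_le: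
  fixes f g :: "'a \<Rightarrow> real"
  assumes [measurable]: "f \<in> borel_measurable M" "g \<in> borel_measurable M"
  shows "(\<integral>\<^sup>+x. ennreal ((f x + g x)\<^sup>2) \<partial>M)
    \<le> 2 * (\<integral>\<^sup>+x. ennreal ((f x)\<^sup>2) \<partial>M) + 2 * (\<integral>\<^sup>+x. ennreal ((g x)\<^sup>2) \<partial>M)"
proof -
  have "ennreal ((f x + g x)\<^sup>2) \<le> 2 * ennreal ((f x)\<^sup>2) + 2 * ennreal ((g x)\<^sup>2)" for x
  proof -
    have "(f x + g x)\<^sup>2 \<le> 2 * (f x)\<^sup>2 + 2 * (g x)\<^sup>2"
      using sum_squares_bound[of "f x" "g x"] by (simp add: power2_sum)
    then have "ennreal ((f x + g x)\<^sup>2) \<le> ennreal (2 * (f x)\<^sup>2 + 2 * (g x)\<^sup>2)"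
      by (rule ennreal_leI)
    then show ?thesis
      by (simp add: ennreal_mult')
  qed
  then have "(\<integral>\<^sup>+x. ennreal ((f x + g x)\<^sup>2) \<partial>M)
    \<le> (\<integral>\<^sup>+x. 2 * ennreal ((f x)\<^sup>2) + 2 * ennreal ((g x)\<^sup>2) \<partial>M)"
    by (intro nn_integral_mono) auto
  also have "\<dots> = 2 * (\<integral>\<^sup>+x. ennreal ((f x)\<^sup>2) \<partial>M) + 2 * (\<integral>\<^sup>+x. ennreal ((g x)\<^sup>2) \<partial>M)"
    by (simp add: nn_integral_add nn_integral_cmult)
  finally show ?thesis .
qed

lemma tendsto_zero_ennreal_le:
  fixes f g :: "nat \<Rightarrow> ennreal"
  assumes "g \<longlonglongrightarrow> 0" and "\<And>m. f m \<le> c * g m" and "c < top"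
  shows "f \<longlonglongrightarrow> 0"
proof (rule tendsto_sandwich[of "\<lambda>_. 0"])
  show "(\<lambda>m. c * g m) \<longlonglongrightarrow> 0"
    using ennreal_tendsto_cmult[OF assms(3,1)] by simp
qed (use assms(2) in auto)

lemma nn_integral_square_add_tendsto_zero:
  fixes f g :: "nat \<Rightarrow> 'a \<Rightarrow> real"
  assumes "\<And>m. f m \<in> borel_measurable M" "\<And>m. g m \<in> borel_measurable M"
    and "(\<lambda>m. \<integral>\<^sup>+x. ennreal ((f m x)\<^sup>2) \<partial>M) \<longlonglongrightarrow> 0"
    and "(\<lambda>m. \<integral>\<^sup>+x. ennreal ((g m x)\<^sup>2) \<partial>M) \<longlonglongrightarrow> 0"
  shows "(\<lambda>m. \<integral>\<^sup>+x. ennreal ((f m x + g m x)\<^sup>2) \<partial>M) \<longlonglongrightarrow> 0"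
proof (rule tendsto_zero_ennreal_le)
  show "(\<lambda>m. (\<integral>\<^sup>+x. ennreal ((f m x)\<^sup>2) \<partial>M) + (\<integral>\<^sup>+x. ennreal ((g m x)\<^sup>2) \<partial>M)) \<longlonglongrightarrow> 0"
    using tendsto_add[OF assms(3,4)] by simp
  show "(\<integral>\<^sup>+x. ennreal ((f m x + g m x)\<^sup>2) \<partial>M)
    \<le> 2 * ((\<integral>\<^sup>+x. ennreal ((f m x)\<^sup>2) \<partial>M) + (\<integral>\<^sup>+x. ennreal ((g m x)\<^sup>2) \<partial>M))" for m
    using nn_integral_square_add_le[OF assms(1,2)] by (simp add: distrib_left)
qed simp

lemma nn_integral_square_scale:
  fixes f :: "'a \<Rightarrow> real"
  assumes "f \<in> borel_measurable M"
  shows "(\<integral>\<^sup>+x. ennreal ((a * f x)\<^sup>2) \<partial>M) = ennreal (a\<^sup>2) * (\<integral>\<^sup>+x. ennreal ((f x)\<^sup>2) \<partial>M)"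
  using assms by (simp add: power_mult_distrib ennreal_mult nn_integral_cmult)

context real_brownian_motion
begin

text \<open>The time interval is built into \<open>H\<close> as an indicator, so that integrals over
  different intervals can be subtracted. The approximants may be random although \<open>H\<close> is
  deterministic, because a given Ito integral comes with arbitrary simple processes.\<close>

definition wiener_integral :: "(real \<Rightarrow> real) \<Rightarrow> ('a \<Rightarrow> real) \<Rightarrow> bool" where
  "wiener_integral H I \<longleftrightarrow> H \<in> borel_measurable borel \<and> I \<in> borel_measurable M \<and>
    (\<exists>V S. (\<forall>m. simple_pair (V m) (S m)) \<and>
      (\<lambda>m. \<integral>\<^sup>+z. ennreal ((V m z - H (snd z))\<^sup>2) \<partial>N) \<longlonglongrightarrow> 0 \<and>
      (\<lambda>m. \<integral>\<^sup>+\<omega>. ennreal ((S m \<omega> - I \<omega>)\<^sup>2) \<partial>M) \<longlonglongrightarrow> 0)"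

lemma wiener_integral_measurable:
  assumes "wiener_integral H I"
  shows "H \<in> borel_measurable borel" and "I \<in> borel_measurable M"
  using assms by (auto simp: wiener_integral_def)

lemma wiener_integral_step:
  assumes "0 \<le> s" "s \<le> t"
  shows "wiener_integral (\<lambda>u. c * indicator {s<..t} u) (\<lambda>\<omega>. c * (B t \<omega> - B s \<omega>))"
  unfolding wiener_integral_def
proof (intro conjI exI allI)
  show "simple_pair (\<lambda>(\<omega>, u). c * indicator {s<..t} u) (\<lambda>\<omega>. c * (B t \<omega> - B s \<omega>))"
    using assms by (intro simple_pair.step[where C="\<bar>c\<bar>"]) auto
qed (use B_measurable[of s] B_measurable[of t] assms in \<open>auto simp: case_prod_unfold\<close>)

lemma wiener_integral_add:
  assumes "wiener_integral H I" "wiener_integral H' I'"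
  shows "wiener_integral (\<lambda>u. H u + H' u) (\<lambda>\<omega>. I \<omega> + I' \<omega>)"
proof -
  note [measurable] = wiener_integral_measurable[OF assms(1)] wiener_integral_measurable[OF assms(2)]
  obtain V S where p: "\<And>m. simple_pair (V m) (S m)"
      "(\<lambda>m. \<integral>\<^sup>+z. ennreal ((V m z - H (snd z))\<^sup>2) \<partial>N) \<longlonglongrightarrow> 0"
      "(\<lambda>m. \<integral>\<^sup>+\<omega>. ennreal ((S m \<omega> - I \<omega>)\<^sup>2) \<partial>M) \<longlonglongrightarrow> 0"
    using assms(1) unfolding wiener_integral_def by blast
  obtain V' S' where p': "\<And>m. simple_pair (V' m) (S' m)"
      "(\<lambda>m. \<integral>\<^sup>+z. ennreal ((V' m z - H' (snd z))\<^sup>2) \<partial>N) \<longlonglongrightarrow> 0"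
      "(\<lambda>m. \<integral>\<^sup>+\<omega>. ennreal ((S' m \<omega> - I' \<omega>)\<^sup>2) \<partial>M) \<longlonglongrightarrow> 0"
    using assms(2) unfolding wiener_integral_def by blast
  have [measurable]: "V m \<in> borel_measurable N" "V' m \<in> borel_measurable N"
      "S m \<in> borel_measurable M" "S' m \<in> borel_measurable M" for m
    using simple_pair_measurable[OF p(1)] simple_pair_measurable[OF p'(1)] by auto
  show ?thesis
    unfolding wiener_integral_def
  proof (intro conjI exI allI)
    show "simple_pair (\<lambda>z. V m z + V' m z) (\<lambda>\<omega>. S m \<omega> + S' m \<omega>)" for m
      using p(1) p'(1) by (rule simple_pair.add)
    show "(\<lambda>m. \<integral>\<^sup>+z. ennreal ((V m z + V' m z - (H (snd z) + H' (snd z)))\<^sup>2) \<partial>N) \<longlonglongrightarrow> 0"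
      using nn_integral_square_add_tendsto_zero[OF _ _ p(2) p'(2)] by (simp add: add_diff_add)
    show "(\<lambda>m. \<integral>\<^sup>+\<omega>. ennreal ((S m \<omega> + S' m \<omega> - (I \<omega> + I' \<omega>))\<^sup>2) \<partial>M) \<longlonglongrightarrow> 0"
      using nn_integral_square_add_tendsto_zero[OF _ _ p(3) p'(3)] by (simp add: add_diff_add)
  qed measurable
qed

lemma wiener_integral_scale:
  assumes "wiener_integral H I"
  shows "wiener_integral (\<lambda>u. a * H u) (\<lambda>\<omega>. a * I \<omega>)"
proof -
  note [measurable] = wiener_integral_measurable[OF assms]
  obtain V S where p: "\<And>m. simple_pair (V m) (S m)"
      "(\<lambda>m. \<integral>\<^sup>+z. ennreal ((V m z - H (snd z))\<^sup>2) \<partial>N) \<longlonglongrightarrow> 0"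
      "(\<lambda>m. \<integral>\<^sup>+\<omega>. ennreal ((S m \<omega> - I \<omega>)\<^sup>2) \<partial>M) \<longlonglongrightarrow> 0"
    using assms unfolding wiener_integral_def by blast
  have [measurable]: "V m \<in> borel_measurable N" "S m \<in> borel_measurable M" for m
    using simple_pair_measurable[OF p(1)] by auto
  show ?thesis
    unfolding wiener_integral_def
  proof (intro conjI exI allI)
    show "simple_pair (\<lambda>z. a * V m z) (\<lambda>\<omega>. a * S m \<omega>)" for m
      using p(1) by (rule simple_pair_scale)
    have "(\<integral>\<^sup>+z. ennreal ((a * V m z - a * H (snd z))\<^sup>2) \<partial>N)
        = ennreal (a\<^sup>2) * (\<integral>\<^sup>+z. ennreal ((V m z - H (snd z))\<^sup>2) \<partial>N)" for m
      unfolding right_diff_distrib[symmetric] by (rule nn_integral_square_scale) measurable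
    then show "(\<lambda>m. \<integral>\<^sup>+z. ennreal ((a * V m z - a * H (snd z))\<^sup>2) \<partial>N) \<longlonglongrightarrow> 0"
      using tendsto_zero_ennreal_le[OF p(2), of _ "ennreal (a\<^sup>2)"] by simp
    have "(\<integral>\<^sup>+\<omega>. ennreal ((a * S m \<omega> - a * I \<omega>)\<^sup>2) \<partial>M)
        = ennreal (a\<^sup>2) * (\<integral>\<^sup>+\<omega>. ennreal ((S m \<omega> - I \<omega>)\<^sup>2) \<partial>M)" for m
      unfolding right_diff_distrib[symmetric] by (rule nn_integral_square_scale) measurable
    then show "(\<lambda>m. \<integral>\<^sup>+\<omega>. ennreal ((a * S m \<omega> - a * I \<omega>)\<^sup>2) \<partial>M) \<longlonglongrightarrow> 0"
      using tendsto_zero_ennreal_le[OF p(3), of _ "ennreal (a\<^sup>2)"] by simp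
  qed measurable
qed

lemma wiener_integral_diff:
  assumes "wiener_integral H I" "wiener_integral H' I'"
  shows "wiener_integral (\<lambda>u. H u - H' u) (\<lambda>\<omega>. I \<omega> - I' \<omega>)"
  using wiener_integral_add[OF assms(1) wiener_integral_scale[OF assms(2), of "-1"]] by simp

lemma wiener_integral_sum:
  assumes "\<And>k. k \<in> K \<Longrightarrow> wiener_integral (H k) (I k)"
  shows "wiener_integral (\<lambda>u. \<Sum>k\<in>K. H k u) (\<lambda>\<omega>. \<Sum>k\<in>K. I k \<omega>)"
proof -
  have "wiener_integral (\<lambda>_. 0) (\<lambda>_. 0)"
    using wiener_integral_step[of 0 0 0] by simp
  then show ?thesis
    using assms by (induction K rule: infinite_finite_induct) (auto intro: wiener_integral_add)
qed

text \<open>Ito isometry up to a constant: replacing \<open>I\<close> by \<open>S m\<close> costs a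
  factor 2, replacing \<open>V m\<close> by \<open>H\<close> another one, and both errors vanish in
  the limit. A finite constant is enough for deducing convergence to 0.\<close>

lemma wiener_integral_square_le:
  assumes "wiener_integral H I"
  shows "(\<integral>\<^sup>+\<omega>. ennreal ((I \<omega>)\<^sup>2) \<partial>M) \<le> 4 * (\<integral>\<^sup>+u. ennreal ((H u)\<^sup>2) \<partial>lborel)"
proof -
  note [measurable] = wiener_integral_measurable[OF assms]
  obtain V S where p: "\<And>m. simple_pair (V m) (S m)"
      "(\<lambda>m. \<integral>\<^sup>+z. ennreal ((V m z - H (snd z))\<^sup>2) \<partial>N) \<longlonglongrightarrow> 0"
      "(\<lambda>m. \<integral>\<^sup>+\<omega>. ennreal ((S m \<omega> - I \<omega>)\<^sup>2) \<partial>M) \<longlonglongrightarrow> 0"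
    using assms unfolding wiener_integral_def by blast
  have [measurable]: "V m \<in> borel_measurable N" "S m \<in> borel_measurable M" for m
    using simple_pair_measurable[OF p(1)] by auto
  define v where "v m = (\<integral>\<^sup>+z. ennreal ((V m z - H (snd z))\<^sup>2) \<partial>N)" for m
  define s where "s m = (\<integral>\<^sup>+\<omega>. ennreal ((S m \<omega> - I \<omega>)\<^sup>2) \<partial>M)" for m
  define h where "h = (\<integral>\<^sup>+u. ennreal ((H u)\<^sup>2) \<partial>lborel)"
  have h: "(\<integral>\<^sup>+z. ennreal ((H (snd z))\<^sup>2) \<partial>N) = h"
    unfolding h_def by (subst lborel.nn_integral_fst[symmetric]) (simp_all add: emeasure_space_1)
  have "(\<integral>\<^sup>+\<omega>. ennreal ((I \<omega>)\<^sup>2) \<partial>M) \<le> 2 * s m + 2 * (2 * v m + 2 * h)" for m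
  proof -
    have "(\<integral>\<^sup>+\<omega>. ennreal ((I \<omega>)\<^sup>2) \<partial>M) \<le> 2 * s m + 2 * (\<integral>\<^sup>+\<omega>. ennreal ((S m \<omega>)\<^sup>2) \<partial>M)"
      using nn_integral_square_add_le[of "\<lambda>\<omega>. I \<omega> - S m \<omega>" M "S m"]
      by (simp add: s_def power2_commute)
    also have "(\<integral>\<^sup>+\<omega>. ennreal ((S m \<omega>)\<^sup>2) \<partial>M) = (\<integral>\<^sup>+z. ennreal ((V m z)\<^sup>2) \<partial>N)"
      by (rule simple_pair_nn_isometry) fact
    also have "\<dots> \<le> 2 * v m + 2 * h"
      using nn_integral_square_add_le[of "\<lambda>z. V m z - H (snd z)" N "\<lambda>z. H (snd z)"]
      by (simp add: v_def h)
    finally show ?thesis by (simp add: mult_left_mono add_left_mono)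
  qed
  moreover have "(\<lambda>m. 2 * s m + 2 * (2 * v m + 2 * h)) \<longlonglongrightarrow> 2 * 0 + 2 * (2 * 0 + 2 * h)"
    using p(2,3) unfolding v_def[symmetric] s_def[symmetric]
    by (intro tendsto_add ennreal_tendsto_cmult tendsto_const) simp_all
  ultimately have "(\<integral>\<^sup>+\<omega>. ennreal ((I \<omega>)\<^sup>2) \<partial>M) \<le> 2 * 0 + 2 * (2 * 0 + 2 * h)"
    by (intro LIMSEQ_le_const) auto
  then show ?thesis
    by (simp add: h_def flip: mult.assoc)
qed

text \<open>No completeness of \<open>L\<^sup>2\<close> is needed: by Fatou's lemma an almost sure limit of integrals whose
  integrands converge in \<open>L\<^sup>2\<close> is also the \<open>L\<^sup>2\<close>-limit of every other such sequence.\<close>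

lemma wiener_integral_L2_limit:
  assumes G: "\<And>m. wiener_integral (g m) (G m)" and R: "\<And>n. wiener_integral (r n) (R n)"
    and f: "f \<in> borel_measurable borel" and I: "I \<in> borel_measurable M"
    and g_lim: "(\<lambda>m. \<integral>\<^sup>+u. ennreal ((g m u - f u)\<^sup>2) \<partial>lborel) \<longlonglongrightarrow> 0"
    and r_lim: "(\<lambda>n. \<integral>\<^sup>+u. ennreal ((r n u - f u)\<^sup>2) \<partial>lborel) \<longlonglongrightarrow> 0"
    and ae: "AE \<omega> in M. (\<lambda>n. R n \<omega>) \<longlonglongrightarrow> I \<omega>"
  shows "(\<lambda>m. \<integral>\<^sup>+\<omega>. ennreal ((G m \<omega> - I \<omega>)\<^sup>2) \<partial>M) \<longlonglongrightarrow> 0"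
proof (rule tendsto_zero_ennreal_le[OF g_lim])
  fix m
  note [measurable] = wiener_integral_measurable[OF G] wiener_integral_measurable[OF R] f I
  define a where "a = (\<integral>\<^sup>+u. ennreal ((g m u - f u)\<^sup>2) \<partial>lborel)"
  define b where "b n = (\<integral>\<^sup>+u. ennreal ((r n u - f u)\<^sup>2) \<partial>lborel)" for n
  have "(\<integral>\<^sup>+\<omega>. ennreal ((G m \<omega> - I \<omega>)\<^sup>2) \<partial>M)
      = (\<integral>\<^sup>+\<omega>. liminf (\<lambda>n. ennreal ((G m \<omega> - R n \<omega>)\<^sup>2)) \<partial>M)"
  proof (rule nn_integral_cong_AE)
    show "AE \<omega> in M. ennreal ((G m \<omega> - I \<omega>)\<^sup>2) = liminf (\<lambda>n. ennreal ((G m \<omega> - R n \<omega>)\<^sup>2))"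
      using ae
    proof eventually_elim
      case (elim \<omega>)
      then have "(\<lambda>n. ennreal ((G m \<omega> - R n \<omega>)\<^sup>2)) \<longlonglongrightarrow> ennreal ((G m \<omega> - I \<omega>)\<^sup>2)"
        by (intro tendsto_ennrealI tendsto_power tendsto_diff tendsto_const)
      then show ?case
        by (intro lim_imp_Liminf[symmetric]) auto
    qed
  qed
  also have "\<dots> \<le> liminf (\<lambda>n. \<integral>\<^sup>+\<omega>. ennreal ((G m \<omega> - R n \<omega>)\<^sup>2) \<partial>M)"
    by (rule nn_integral_liminf) measurable
  also have "\<dots> \<le> liminf (\<lambda>n. 4 * (2 * a + 2 * b n))"
  proof (intro Liminf_mono always_eventually allI)
    fix n
    have "(\<integral>\<^sup>+\<omega>. ennreal ((G m \<omega> - R n \<omega>)\<^sup>2) \<partial>M) \<le> 4 * (\<integral>\<^sup>+u. ennreal ((g m u - r n u)\<^sup>2) \<partial>lborel)"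
      by (intro wiener_integral_square_le wiener_integral_diff G R)
    also have "(\<integral>\<^sup>+u. ennreal ((g m u - r n u)\<^sup>2) \<partial>lborel) \<le> 2 * a + 2 * b n"
      using nn_integral_square_add_le[of "\<lambda>u. g m u - f u" lborel "\<lambda>u. f u - r n u"]
      by (simp add: a_def b_def power2_commute)
    finally show "(\<integral>\<^sup>+\<omega>. ennreal ((G m \<omega> - R n \<omega>)\<^sup>2) \<partial>M) \<le> 4 * (2 * a + 2 * b n)"
      by (simp add: mult_left_mono)
  qed
  also have "liminf (\<lambda>n. 4 * (2 * a + 2 * b n)) = 4 * (2 * a + 2 * 0)"
    using r_lim unfolding b_def[symmetric]
    by (intro lim_imp_Liminf tendsto_add ennreal_tendsto_cmult tendsto_const) simp_all
  \<comment> \<open>8 = 4 * 2: the 4 is that of \<open>wiener_integral_square_le\<close>, the 2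
    comes from inserting \<open>f\<close> between \<open>g m\<close> and \<open>r n\<close>.\<close>
  finally show "(\<integral>\<^sup>+\<omega>. ennreal ((G m \<omega> - I \<omega>)\<^sup>2) \<partial>M)
      \<le> 8 * (\<integral>\<^sup>+u. ennreal ((g m u - f u)\<^sup>2) \<partial>lborel)"
    by (simp add: a_def flip: mult.assoc)
qed simp

end

section \<open>Step functions on uniform partitions\<close>

text \<open>There are \<open>Suc m\<close> cells, so the denominator never vanishes and cells are
  numbered by \<open>k \<le> m\<close>.\<close>

definition node :: "real \<Rightarrow> nat \<Rightarrow> nat \<Rightarrow> real" where
  "node T m k = T * real k / real (Suc m)"

text \<open>Cells are open on the left as in \<open>simple_value\<close>, so for nonnegative
  \<open>T\<close> the value at time 0 is 0, whatever \<open>c\<close> is.\<close>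

definition grid_fun :: "real \<Rightarrow> nat \<Rightarrow> (nat \<Rightarrow> real) \<Rightarrow> real \<Rightarrow> real" where
  "grid_fun T m c u = (\<Sum>k\<le>m. c k * indicator {node T m k<..node T m (Suc k)} u)"

lemma node_0 [simp]: "node T m 0 = 0" and node_last [simp]: "node T m (Suc m) = T"
  by (simp_all add: node_def)

lemma node_mono: "0 \<le> T \<Longrightarrow> j \<le> k \<Longrightarrow> node T m j \<le> node T m k"
  unfolding node_def by (intro divide_right_mono mult_left_mono) auto

lemma node_bounds:
  assumes "0 \<le> T" "k \<le> Suc m"
  shows "0 \<le> node T m k" "node T m k \<le> T"
  using node_mono[OF assms(1), of 0 k m] node_mono[OF assms, of m] by simp_all

lemma node_Suc: "node T m (Suc k) = node T m k + T / real (Suc m)"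
  by (simp add: node_def distrib_left add_divide_distrib)

lemma grid_fun_outside:
  assumes "0 \<le> T" "u \<notin> {0<..T}"
  shows "grid_fun T m c u = 0"
  unfolding grid_fun_def
proof (rule sum.neutral, rule ballI)
  fix k assume "k \<in> {..m}"
  then have "0 \<le> node T m k" "node T m (Suc k) \<le> T"
    using node_bounds[OF assms(1), of k m] node_bounds[OF assms(1), of "Suc k" m] by auto
  with assms(2) have "u \<notin> {node T m k<..node T m (Suc k)}" by auto
  then show "c k * indicator {node T m k<..node T m (Suc k)} u = 0" by simp
qed

lemma grid_fun_inside:
  assumes u: "u \<in> {0<..T}"
  obtains k where "k \<le> m" "node T m k < u" "u \<le> node T m (Suc k)" "\<And>c. grid_fun T m c u = c k"
proof -
  have T: "0 < T" using u by auto
  define k where "k = (LEAST k. u \<le> node T m (Suc k))"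
  have ex: "u \<le> node T m (Suc m)" using u by simp
  have 1: "u \<le> node T m (Suc k)"
    unfolding k_def by (rule LeastI, rule ex)
  have 2: "k \<le> m"
    unfolding k_def by (rule Least_le, rule ex)
  have 3: "node T m k < u"
  proof (cases k)
    case 0
    with u show ?thesis by simp
  next
    case (Suc j)
    then have "\<not> u \<le> node T m (Suc j)"
      using not_less_Least[of j "\<lambda>k. u \<le> node T m (Suc k)"] unfolding k_def[symmetric] by simp
    with Suc show ?thesis by simp
  qed
  have ind: "indicator {node T m j<..node T m (Suc j)} u = (if j = k then 1 else 0 :: real)" for j
  proof -
    have "u \<notin> {node T m j<..node T m (Suc j)}" if "j \<noteq> k"
    proof (cases "j < k")
      case True
      then have "node T m (Suc j) \<le> node T m k" using T by (intro node_mono) auto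
      with 3 show ?thesis by auto
    next
      case False
      with that have "node T m (Suc k) \<le> node T m j" using T by (intro node_mono) auto
      with 1 show ?thesis by auto
    qed
    with 1 3 show ?thesis by auto
  qed
  have "grid_fun T m c u = c k" for c
    unfolding grid_fun_def ind using 2 by (simp add: if_distrib cong: if_cong)
  with 1 2 3 that show ?thesis by blast
qed

text \<open>The offset \<open>j\<close> chooses the endpoint of the cell at which \<open>f\<close>
  is sampled: the left one (0) for stochastic sums, which must not look ahead, the right one (1) for
  the Riemann-Stieltjes sum.\<close>

lemma grid_fun_sample:
  assumes u: "u \<in> {0<..T}" and j: "j \<le> 1"
  obtains v where "v \<in> {0..T}" "\<bar>v - u\<bar> \<le> T / real (Suc m)"
    "\<And>f. grid_fun T m (\<lambda>k. f (node T m (k + j))) u = f v"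
proof -
  have T: "0 \<le> T" using u by auto
  obtain k where k: "k \<le> m" "node T m k < u" "u \<le> node T m (Suc k)" "\<And>c. grid_fun T m c u = c k"
    using grid_fun_inside[OF u] by blast
  show ?thesis
  proof
    show "node T m (k + j) \<in> {0..T}"
      using node_bounds[OF T, of "k + j" m] k(1) j by auto
    have "j = 0 \<or> j = 1" using j by auto
    then show "\<bar>node T m (k + j) - u\<bar> \<le> T / real (Suc m)"
      using k(2,3) node_Suc[of T m k] by auto
    show "grid_fun T m (\<lambda>k. f (node T m (k + j))) u = f (node T m (k + j))" for f
      by (rule k(4))
  qed
qed

lemma grid_fun_tendsto:
  assumes f: "continuous_on {0..T} f" and u: "u \<in> {0<..T}" and j: "j \<le> 1"
  shows "(\<lambda>m. grid_fun T m (\<lambda>k. f (node T m (k + j))) u) \<longlonglongrightarrow> f u"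
proof -
  have "\<exists>v. v \<in> {0..T} \<and> \<bar>v - u\<bar> \<le> T / real (Suc m) \<and>
      grid_fun T m (\<lambda>k. f (node T m (k + j))) u = f v" for m
    by (rule grid_fun_sample[OF u j, of m]) blast
  then obtain v where v: "\<And>m. v m \<in> {0..T}" "\<And>m. \<bar>v m - u\<bar> \<le> T / real (Suc m)"
      "\<And>m. grid_fun T m (\<lambda>k. f (node T m (k + j))) u = f (v m)"
    by metis
  have "(\<lambda>m. v m - u) \<longlonglongrightarrow> 0"
  proof (rule tendsto_rabs_zero_cancel, rule tendsto_sandwich[of "\<lambda>_. 0"])
    show "(\<lambda>m. T / real (Suc m)) \<longlonglongrightarrow> 0"
      by (rule LIMSEQ_Suc[OF lim_const_over_n])
  qed (use v(2) in auto)
  then have "v \<longlonglongrightarrow> u" by (simp add: LIM_zero_iff)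
  then have "(\<lambda>m. f (v m)) \<longlonglongrightarrow> f u"
    using v(1) u by (intro continuous_on_tendsto_compose[OF f]) auto
  then show ?thesis by (simp add: v(3))
qed

lemma continuous_on_Icc_bounded:
  fixes f :: "real \<Rightarrow> real"
  assumes "continuous_on {a..b} f"
  obtains C where "0 \<le> C" "\<forall>u\<in>{a..b}. \<bar>f u\<bar> \<le> C"
proof -
  have "bounded (f ` {a..b})"
    using assms by (intro compact_imp_bounded compact_continuous_image) auto
  then obtain C where "0 < C" "\<forall>u\<in>{a..b}. \<bar>f u\<bar> \<le> C"
    unfolding bounded_pos by auto
  then show ?thesis by (intro that[of C]) auto
qed

lemma grid_fun_bounded:
  assumes T: "0 \<le> T" and j: "j \<le> 1" and C: "\<forall>u\<in>{0..T}. \<bar>f u\<bar> \<le> C"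
  shows "\<bar>grid_fun T m (\<lambda>k. f (node T m (k + j))) u\<bar> \<le> C * indicator {0<..T} u"
proof (cases "u \<in> {0<..T}")
  case True
  show ?thesis
    by (rule grid_fun_sample[OF True j, of m]) (use C True in simp)
qed (simp add: grid_fun_outside[OF T])

lemma grid_fun_measurable [measurable]: "grid_fun T m c \<in> borel_measurable borel"
  unfolding grid_fun_def[abs_def] by measurable

lemma borel_measurable_continuous_times_indicator:
  fixes f :: "real \<Rightarrow> real"
  assumes "continuous_on {0..T} f"
  shows "(\<lambda>u. f u * indicator {0<..T} u) \<in> borel_measurable borel"
proof -
  have "continuous_on {0<..T} f"
    using assms by (rule continuous_on_subset) auto
  from borel_measurable_continuous_on_indicator[OF _ this] show ?thesis
    by (simp add: mult.commute)
qed

lemma nn_integral_square_tendsto_zero: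
  fixes d :: "nat \<Rightarrow> real \<Rightarrow> real"
  assumes meas: "\<And>m. d m \<in> borel_measurable borel"
    and bound: "\<And>m u. \<bar>d m u\<bar> \<le> C * indicator {0<..T} u"
    and lim: "\<And>u. u \<in> {0<..T} \<Longrightarrow> (\<lambda>m. d m u) \<longlonglongrightarrow> 0"
  shows "(\<lambda>m. \<integral>\<^sup>+u. ennreal ((d m u)\<^sup>2) \<partial>lborel) \<longlonglongrightarrow> 0"
proof -
  note [measurable] = meas
  have "(\<lambda>m. \<integral>\<^sup>+u. ennreal ((d m u)\<^sup>2) \<partial>lborel) \<longlonglongrightarrow> (\<integral>\<^sup>+u. 0 \<partial>(lborel :: real measure))"
  proof (rule nn_integral_dominated_convergence[where w="\<lambda>u. ennreal (C\<^sup>2) * indicator {0<..T} u"])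
    show "(\<integral>\<^sup>+u. ennreal (C\<^sup>2) * indicator {0<..T} u \<partial>lborel) < \<infinity>"
      by (cases "0 \<le> T") (simp_all add: nn_integral_cmult ennreal_mult_less_top)
    show "AE u in lborel. ennreal ((d m u)\<^sup>2) \<le> ennreal (C\<^sup>2) * indicator {0<..T} u" for m
    proof (rule AE_I2)
      fix u
      have "(d m u)\<^sup>2 \<le> (C * indicator {0<..T} u)\<^sup>2"
        using power_mono[OF bound[of m u], of 2] by simp
      then show "ennreal ((d m u)\<^sup>2) \<le> ennreal (C\<^sup>2) * indicator {0<..T} u"
        by (auto simp: indicator_def)
    qed
    show "AE u in lborel. (\<lambda>m. ennreal ((d m u)\<^sup>2)) \<longlonglongrightarrow> 0"
    proof (rule AE_I2)
      fix u
      have "(\<lambda>m. d m u) \<longlonglongrightarrow> 0"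
      proof (cases "u \<in> {0<..T}")
        case False
        then have "d m u = 0" for m using bound[of m u] by simp
        then show ?thesis by simp
      qed (rule lim)
      then have "(\<lambda>m. ennreal ((d m u)\<^sup>2)) \<longlonglongrightarrow> ennreal (0\<^sup>2)"
        by (intro tendsto_ennrealI tendsto_power)
      then show "(\<lambda>m. ennreal ((d m u)\<^sup>2)) \<longlonglongrightarrow> 0" by simp
    qed
  qed measurable
  then show ?thesis by simp
qed

text \<open>Only \<open>f\<close> is sampled, the weight \<open>h\<close> stays exact. One argument
  thus serves both approximations of the Ito integrand: \<open>f\<close> is \<open>a\<close> with
  weight \<open>h\<close>, or \<open>a * h\<close> with weight 1. Continuity gives pointwise
  convergence and a bound on the interval, hence dominated convergence.\<close>

lemma grid_fun_L2_tendsto: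
  assumes f: "continuous_on {0..T} f" and h: "continuous_on {0..T} h" and T: "0 \<le> T" and j: "j \<le> 1"
  shows "(\<lambda>m. \<integral>\<^sup>+u. ennreal ((grid_fun T m (\<lambda>k. f (node T m (k + j))) u * (h u * indicator {0<..T} u)
    - f u * h u * indicator {0<..T} u)\<^sup>2) \<partial>lborel) \<longlonglongrightarrow> 0"
proof -
  obtain C where C: "0 \<le> C" "\<forall>u\<in>{0..T}. \<bar>f u\<bar> \<le> C"
    using continuous_on_Icc_bounded[OF f] by blast
  obtain D where D: "0 \<le> D" "\<forall>u\<in>{0..T}. \<bar>h u\<bar> \<le> D"
    using continuous_on_Icc_bounded[OF h] by blast
  note [measurable] = borel_measurable_continuous_times_indicator[OF h]
    borel_measurable_continuous_times_indicator[OF continuous_on_mult[OF f h]]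
  show ?thesis
  proof (rule nn_integral_square_tendsto_zero[where C="2 * C * D"])
    fix m u
    show "\<bar>grid_fun T m (\<lambda>k. f (node T m (k + j))) u * (h u * indicator {0<..T} u)
        - f u * h u * indicator {0<..T} u\<bar> \<le> 2 * C * D * indicator {0<..T} u"
    proof (cases "u \<in> {0<..T}")
      case True
      then have "\<bar>grid_fun T m (\<lambda>k. f (node T m (k + j))) u - f u\<bar> \<le> 2 * C"
        using grid_fun_bounded[OF T j C(2), of m u] C(2)[THEN bspec, of u] by auto
      then have "\<bar>grid_fun T m (\<lambda>k. f (node T m (k + j))) u - f u\<bar> * \<bar>h u\<bar> \<le> 2 * C * D"
        using D True C(1) by (intro mult_mono) auto
      with True show ?thesis
        by (simp add: left_diff_distrib flip: abs_mult)
    qed simp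
  next
    fix u assume u: "u \<in> {0<..T}"
    have "(\<lambda>m. grid_fun T m (\<lambda>k. f (node T m (k + j))) u * (h u * indicator {0<..T} u)
        - f u * h u * indicator {0<..T} u) \<longlonglongrightarrow> f u * (h u * indicator {0<..T} u) - f u * h u * indicator {0<..T} u"
      by (intro tendsto_intros grid_fun_tendsto[OF f u j])
    then show "(\<lambda>m. grid_fun T m (\<lambda>k. f (node T m (k + j))) u * (h u * indicator {0<..T} u)
        - f u * h u * indicator {0<..T} u) \<longlonglongrightarrow> 0" by simp
  qed measurable
qed

text \<open>Each increment of \<open>a\<close> is the integral of \<open>a'\<close> over its cell,
  so the sum is exactly the integral of \<open>a'\<close> times the step function that samples
  \<open>y\<close> at right endpoints. Dominated convergence does the rest.\<close>

lemma riemann_stieltjes_sum_tendsto: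
  fixes a a' y :: "real \<Rightarrow> real"
  assumes T: "0 \<le> T" and a: "\<And>u. u \<in> {0..T} \<Longrightarrow> (a has_real_derivative a' u) (at u)"
    and a': "continuous_on {0..T} a'" and y: "continuous_on {0..T} y"
  shows "(\<lambda>m. \<Sum>k\<le>m. (a (node T m (Suc k)) - a (node T m k)) * y (node T m (Suc k)))
    \<longlonglongrightarrow> (LINT u:{0..T}|lborel. a' u * y u)"
proof -
  define g where "g m = grid_fun T m (\<lambda>k. y (node T m (k + 1)))" for m
  obtain C where C: "0 \<le> C" "\<forall>u\<in>{0..T}. \<bar>y u\<bar> \<le> C"
    using continuous_on_Icc_bounded[OF y] by blast
  have g_bound: "\<bar>g m u\<bar> \<le> C * indicator {0<..T} u" for m u
    unfolding g_def by (rule grid_fun_bounded[OF T _ C(2)]) simp_all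
  obtain D where D: "0 \<le> D" "\<forall>u\<in>{0..T}. \<bar>a' u\<bar> \<le> D"
    using continuous_on_Icc_bounded[OF a'] by blast
  note [measurable] = borel_measurable_continuous_times_indicator[OF a']
    borel_measurable_continuous_times_indicator[OF continuous_on_mult[OF a' y]]
  have sum_eq: "(\<Sum>k\<le>m. (a (node T m (Suc k)) - a (node T m k)) * y (node T m (Suc k)))
      = (\<integral>u. a' u * indicator {0<..T} u * g m u \<partial>lborel)" for m
  proof -
    have cell: "has_bochner_integral lborel (\<lambda>u. a' u * indicator {node T m k<..node T m (Suc k)} u)
        (a (node T m (Suc k)) - a (node T m k))" if "k \<le> m" for k
    proof -
      have le: "0 \<le> node T m k" "node T m k \<le> node T m (Suc k)" "node T m (Suc k) \<le> T"
        using that T node_bounds[of T k m] node_bounds[of T "Suc k" m] node_mono[of T k "Suc k" m] by auto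
      have Icc: "has_bochner_integral lborel (\<lambda>u. indicator {node T m k..node T m (Suc k)} u *\<^sub>R a' u)
        (a (node T m (Suc k)) - a (node T m k))"
      proof (rule has_bochner_integral_FTC_Icc)
        show "continuous_on {node T m k..node T m (Suc k)} a'"
          using a' by (rule continuous_on_subset) (use le in auto)
        fix u assume "node T m k \<le> u" "u \<le> node T m (Suc k)"
        with a[of u] le show "(a has_vector_derivative a' u) (at u within {node T m k..node T m (Suc k)})"
          by (auto simp: has_real_derivative_iff_has_vector_derivative intro: has_vector_derivative_at_within)
      qed (fact le)
      have eq: "AE u in lborel. indicator {node T m k..node T m (Suc k)} u *\<^sub>R a' u
          = a' u * indicator {node T m k<..node T m (Suc k)} u"
        using AE_lborel_singleton[of "node T m k"] by eventually_elim (auto simp: indicator_def)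
      have "(\<lambda>u. a' u * indicator {node T m k<..node T m (Suc k)} u) \<in> borel_measurable lborel"
      proof -
        have "(\<lambda>u. a' u * indicator {node T m k<..node T m (Suc k)} u)
          = (\<lambda>u. a' u * indicator {0<..T} u * indicator {node T m k<..node T m (Suc k)} u)"
          using le by (auto simp: indicator_def)
        then show ?thesis by simp
      qed
      from has_bochner_integral_cong_AE[OF borel_measurable_has_bochner_integral[OF Icc] this eq] Icc
      show ?thesis by simp
    qed
    have "has_bochner_integral lborel
        (\<lambda>u. \<Sum>k\<le>m. a' u * indicator {node T m k<..node T m (Suc k)} u * y (node T m (Suc k)))
        (\<Sum>k\<le>m. (a (node T m (Suc k)) - a (node T m k)) * y (node T m (Suc k)))"
      by (intro has_bochner_integral_sum has_bochner_integral_mult_left cell) auto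
    moreover have "(\<Sum>k\<le>m. a' u * indicator {node T m k<..node T m (Suc k)} u * y (node T m (Suc k)))
        = a' u * indicator {0<..T} u * g m u" for u
    proof -
      have "(\<Sum>k\<le>m. a' u * indicator {node T m k<..node T m (Suc k)} u * y (node T m (Suc k))) = a' u * g m u"
        unfolding g_def grid_fun_def sum_distrib_left by (intro sum.cong) simp_all
      also have "\<dots> = a' u * indicator {0<..T} u * g m u"
        using grid_fun_outside[OF T, of u m] by (cases "u \<in> {0<..T}") (auto simp: g_def)
      finally show ?thesis .
    qed
    ultimately show ?thesis
      by (simp add: has_bochner_integral_integral_eq)
  qed
  have "(\<lambda>m. \<integral>u. a' u * indicator {0<..T} u * g m u \<partial>lborel)
      \<longlonglongrightarrow> (\<integral>u. a' u * y u * indicator {0<..T} u \<partial>lborel)"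
  proof (rule integral_dominated_convergence[where w="\<lambda>u. D * C * indicator {0<..T} u"])
    show "integrable lborel (\<lambda>u. D * C * indicator {0<..T} u)"
      using T by (intro integrable_mult_right integrable_real_indicator) auto
    show "AE u in lborel. (\<lambda>m. a' u * indicator {0<..T} u * g m u) \<longlonglongrightarrow> a' u * y u * indicator {0<..T} u"
    proof (rule AE_I2)
      fix u
      show "(\<lambda>m. a' u * indicator {0<..T} u * g m u) \<longlonglongrightarrow> a' u * y u * indicator {0<..T} u"
      proof (cases "u \<in> {0<..T}")
        case True
        then show ?thesis
          using tendsto_mult_left[OF grid_fun_tendsto[OF y True, of 1], of "a' u"] by (simp add: g_def)
      qed simp
    qed
    show "AE u in lborel. norm (a' u * indicator {0<..T} u * g m u) \<le> D * C * indicator {0<..T} u" for m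
    proof (rule AE_I2)
      fix u
      show "norm (a' u * indicator {0<..T} u * g m u) \<le> D * C * indicator {0<..T} u"
        using C(1) g_bound[of m u] D by (cases "u \<in> {0<..T}") (auto simp: abs_mult intro!: mult_mono)
    qed
  qed (simp_all add: g_def)
  moreover have "(\<integral>u. a' u * y u * indicator {0<..T} u \<partial>lborel) = (LINT u:{0..T}|lborel. a' u * y u)"
    unfolding set_lebesgue_integral_def
  proof (rule integral_cong_AE)
    show "AE u in lborel. a' u * y u * indicator {0<..T} u = indicator {0..T} u *\<^sub>R (a' u * y u)"
      using AE_lborel_singleton[of 0] by eventually_elim (auto simp: indicator_def)
    show "(\<lambda>u. indicator {0..T} u *\<^sub>R (a' u * y u)) \<in> borel_measurable lborel"
      using borel_measurable_continuous_on_indicator[OF _ continuous_on_mult[OF a' y]] by simp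
  qed simp
  ultimately show ?thesis
    by (simp add: sum_eq)
qed

section \<open>Integration by parts\<close>

text \<open>Allows the integral over \<open>{0..T}\<close> in \<open>has_ito_integral\<close> to be
  extended to the whole line, as \<open>wiener_integral\<close> requires.\<close>

lemma simple_value_outside:
  assumes "simple_process M F T n \<tau> \<xi>" "u \<notin> {0..T}"
  shows "simple_value n \<tau> \<xi> u \<omega> = 0"
  unfolding simple_value_def
proof (rule sum.neutral, rule ballI)
  fix k assume "k \<in> {..<n}"
  then have "k \<le> n" "Suc k \<le> n" by auto
  with assms(1) have "0 \<le> \<tau> k" "\<tau> (Suc k) \<le> T"
    by (auto simp: simple_process_def)
  with assms(2) have "u \<notin> {\<tau> k<..\<tau> (Suc k)}" by auto
  then show "\<xi> k \<omega> * indicator {\<tau> k<..\<tau> (Suc k)} u = 0" by simp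
qed

context real_brownian_motion
begin

lemma simple_pair_simple_process:
  assumes "simple_process M F T n \<tau> \<xi>"
  shows "simple_pair (\<lambda>z. simple_value n \<tau> \<xi> (snd z) (fst z)) (simple_integral B n \<tau> \<xi>)"
proof -
  have "simple_pair (\<lambda>z. case z of (\<omega>, u) \<Rightarrow> \<xi> k \<omega> * indicator {\<tau> k<..\<tau> (Suc k)} u)
      (\<lambda>\<omega>. \<xi> k \<omega> * (B (\<tau> (Suc k)) \<omega> - B (\<tau> k) \<omega>))" if "k \<in> {..<n}" for k
  proof -
    from that have "k \<le> n" "k < n" by auto
    with assms obtain C where "0 \<le> \<tau> k" "\<tau> k \<le> \<tau> (Suc k)" "\<xi> k \<in> borel_measurable (F (\<tau> k))"
        "\<forall>\<omega>\<in>space M. \<bar>\<xi> k \<omega>\<bar> \<le> C"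
      unfolding simple_process_def by blast
    then show ?thesis by (rule simple_pair.step)
  qed
  from simple_pair_sum[of "{..<n}", OF this] show ?thesis
    by (simp only: simple_value_def simple_integral_def[abs_def] case_prod_unfold real_scaleR_def)
qed

text \<open>Projection on \<open>v\<close> commutes with the sums that integrate simple processes
  and leaves their scalar coefficients alone. By Cauchy-Schwarz and \<open>norm v = 1\<close> the
  scalar error is at most the vector error.\<close>

lemma wiener_integral_if_has_ito_integral:
  fixes W :: "real \<Rightarrow> 'a \<Rightarrow> 'b::euclidean_space"
  assumes ito: "has_ito_integral M F W s (\<lambda>u \<omega>. h u) I"
    and B: "B = (\<lambda>t \<omega>. v \<bullet> W t \<omega>)" and v: "norm v = 1"
    and h: "(\<lambda>u. h u * indicator {0..s} u) \<in> borel_measurable borel"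
  shows "wiener_integral (\<lambda>u. h u * indicator {0..s} u) (\<lambda>\<omega>. v \<bullet> I \<omega>)"
proof -
  obtain n \<tau> \<xi> where p: "\<And>m. simple_process M F s (n m) (\<tau> m) (\<xi> m)"
    and V: "(\<lambda>m. \<integral>\<^sup>+\<omega>. (\<integral>\<^sup>+u\<in>{0..s}. ennreal ((simple_value (n m) (\<tau> m) (\<xi> m) u \<omega> - h u)\<^sup>2) \<partial>lborel) \<partial>M)
          \<longlonglongrightarrow> 0"
    and S: "(\<lambda>m. \<integral>\<^sup>+\<omega>. ennreal ((norm (simple_integral W (n m) (\<tau> m) (\<xi> m) \<omega> - I \<omega>))\<^sup>2) \<partial>M)
          \<longlonglongrightarrow> 0"
    using ito unfolding has_ito_integral_def by blast
  have [measurable]: "I \<in> borel_measurable M"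
    using ito by (simp add: has_ito_integral_def)
  define V' where "V' m z = simple_value (n m) (\<tau> m) (\<xi> m) (snd z) (fst z)" for m and z :: "'a \<times> real"
  have pair: "simple_pair (V' m) (simple_integral B (n m) (\<tau> m) (\<xi> m))" for m
    using simple_pair_simple_process[OF p, of m] by (simp add: V'_def[abs_def])
  have [measurable]: "V' m \<in> borel_measurable N" for m
    using simple_pair_measurable[OF pair, of m] by simp
  note [measurable] = h
  show ?thesis
    unfolding wiener_integral_def
  proof (intro conjI exI allI)
    show "simple_pair (V' m) (simple_integral B (n m) (\<tau> m) (\<xi> m))" for m
      by (rule pair)
    have "(\<integral>\<^sup>+z. ennreal ((V' m z - h (snd z) * indicator {0..s} (snd z))\<^sup>2) \<partial>N)
      = (\<integral>\<^sup>+\<omega>. (\<integral>\<^sup>+u\<in>{0..s}. ennreal ((simple_value (n m) (\<tau> m) (\<xi> m) u \<omega> - h u)\<^sup>2) \<partial>lborel) \<partial>M)" for m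
    proof -
      have meas: "(\<lambda>z. ennreal ((V' m z - h (snd z) * indicator {0..s} (snd z))\<^sup>2)) \<in> borel_measurable N"
        by measurable
      have "ennreal ((V' m (\<omega>, u) - h u * indicator {0..s} u)\<^sup>2)
        = ennreal ((simple_value (n m) (\<tau> m) (\<xi> m) u \<omega> - h u)\<^sup>2) * indicator {0..s} u" for \<omega> u
        using simple_value_outside[OF p, of u m \<omega>] by (cases "u \<in> {0..s}") (auto simp: V'_def)
      then show ?thesis
        by (subst lborel.nn_integral_fst[symmetric, OF meas]) simp
    qed
    with V show "(\<lambda>m. \<integral>\<^sup>+z. ennreal ((V' m z - h (snd z) * indicator {0..s} (snd z))\<^sup>2) \<partial>N) \<longlonglongrightarrow> 0"
      by simp
    show "(\<lambda>m. \<integral>\<^sup>+\<omega>. ennreal ((simple_integral B (n m) (\<tau> m) (\<xi> m) \<omega> - v \<bullet> I \<omega>)\<^sup>2) \<partial>M) \<longlonglongrightarrow> 0"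
    proof (rule tendsto_zero_ennreal_le[OF S, where c=1])
      fix m
      have "(simple_integral B (n m) (\<tau> m) (\<xi> m) \<omega> - v \<bullet> I \<omega>)\<^sup>2
        \<le> (norm (simple_integral W (n m) (\<tau> m) (\<xi> m) \<omega> - I \<omega>))\<^sup>2" for \<omega>
      proof -
        have "simple_integral B (n m) (\<tau> m) (\<xi> m) \<omega> - v \<bullet> I \<omega>
            = v \<bullet> (simple_integral W (n m) (\<tau> m) (\<xi> m) \<omega> - I \<omega>)"
          by (simp add: B simple_integral_def inner_sum_right inner_diff_right)
        then have "\<bar>simple_integral B (n m) (\<tau> m) (\<xi> m) \<omega> - v \<bullet> I \<omega>\<bar>
            \<le> norm (simple_integral W (n m) (\<tau> m) (\<xi> m) \<omega> - I \<omega>)"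
          using Cauchy_Schwarz_ineq2[of v "simple_integral W (n m) (\<tau> m) (\<xi> m) \<omega> - I \<omega>"] v by simp
        from power_mono[OF this, of 2] show ?thesis by simp
      qed
      then show "(\<integral>\<^sup>+\<omega>. ennreal ((simple_integral B (n m) (\<tau> m) (\<xi> m) \<omega> - v \<bullet> I \<omega>)\<^sup>2) \<partial>M)
        \<le> 1 * (\<integral>\<^sup>+\<omega>. ennreal ((norm (simple_integral W (n m) (\<tau> m) (\<xi> m) \<omega> - I \<omega>))\<^sup>2) \<partial>M)"
        by (auto intro!: nn_integral_mono ennreal_leI)
    qed simp
  qed measurable
qed

text \<open>\<open>R m\<close> is built from the given integrals \<open>I\<close> and converges
  almost surely, while \<open>G m\<close> integrates simple processes against \<open>B\<close>.
  Their integrands \<open>r m\<close> and \<open>g m\<close> tend to the same \<open>f\<close> in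
  L2, so the limit of \<open>R m\<close> is also the L2 limit of \<open>G m\<close>.\<close>

lemma has_ito_integral_integration_by_parts:
  fixes a a' h :: "real \<Rightarrow> real" and y I :: "real \<Rightarrow> 'a \<Rightarrow> real"
  assumes T: "0 \<le> T" and h: "continuous_on {0..T} h"
    and I: "\<And>s. s \<in> {0..T} \<Longrightarrow> wiener_integral (\<lambda>u. h u * indicator {0..s} u) (I s)"
    and yI: "\<And>s. s \<in> {0..T} \<Longrightarrow> AE \<omega> in M. y s \<omega> = y 0 \<omega> + I s \<omega>"
    and y: "AE \<omega> in M. continuous_on {0..T} (\<lambda>s. y s \<omega>)"
    and a: "\<And>u. u \<in> {0..T} \<Longrightarrow> (a has_real_derivative a' u) (at u)"
    and a': "continuous_on {0..T} a'"
  shows "\<exists>J. has_ito_integral M F B T (\<lambda>u \<omega>. a u * h u) J \<and>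
    (AE \<omega> in M. a T * y T \<omega> = a 0 * y 0 \<omega> + (LINT u:{0..T}|lborel. a' u * y u \<omega>) + J \<omega>)"
proof -
  have a_cont: "continuous_on {0..T} a"
    using a by (meson DERIV_isCont continuous_at_imp_continuous_on)
  have ah: "continuous_on {0..T} (\<lambda>u. a u * h u)"
    using a_cont h by (rule continuous_on_mult)
  have node_in: "node T m k \<in> {0..T}" if "k \<le> Suc m" for m k
    using node_bounds[OF T that] by simp
  define R where "R m \<omega> = (\<Sum>k\<le>m. a (node T m k) * (I (node T m (Suc k)) \<omega> - I (node T m k) \<omega>))" for m \<omega>
  define r where "r m u = grid_fun T m (\<lambda>k. a (node T m (k + 0))) u * (h u * indicator {0<..T} u)" for m u
  define G where "G m \<omega> = (\<Sum>k\<le>m. (a (node T m k) * h (node T m k)) *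
      (B (node T m (Suc k)) \<omega> - B (node T m k) \<omega>))" for m \<omega>
  define g where "g m = grid_fun T m (\<lambda>k. a (node T m (k + 0)) * h (node T m (k + 0)))" for m
  define f where "f u = a u * h u * indicator {0<..T} u" for u
  \<comment> \<open>Being defined for every \<omega>, \<open>lim\<close> gives a measurable function
    at once; on the null set where \<open>R m\<close> diverges its value does not matter.\<close>
  define J where "J \<omega> = lim (\<lambda>m. R m \<omega>)" for \<omega>
  have G: "wiener_integral (g m) (G m)" for m
    unfolding g_def G_def grid_fun_def[abs_def] add_0_right
    by (intro wiener_integral_sum wiener_integral_step) (use T in \<open>auto intro: node_bounds node_mono\<close>)
  have R: "wiener_integral (r m) (R m)" for m
  proof -
    \<comment> \<open>The integral over a cell is a difference of integrals from 0; the difference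
      of the two closed-interval indicators is that of the half-open cell.\<close>
    have "wiener_integral (\<lambda>u. \<Sum>k\<le>m. a (node T m k) *
        (h u * indicator {0..node T m (Suc k)} u - h u * indicator {0..node T m k} u)) (R m)"
      unfolding R_def
      by (intro wiener_integral_sum wiener_integral_scale wiener_integral_diff I node_in) auto
    also have "(\<lambda>u. \<Sum>k\<le>m. a (node T m k) *
        (h u * indicator {0..node T m (Suc k)} u - h u * indicator {0..node T m k} u)) = r m"
    proof
      fix u
      have "(\<Sum>k\<le>m. a (node T m k) * (h u * indicator {0..node T m (Suc k)} u - h u * indicator {0..node T m k} u))
        = (\<Sum>k\<le>m. a (node T m k) * indicator {node T m k<..node T m (Suc k)} u * h u)"
      proof (rule sum.cong[OF refl])
        fix k assume "k \<in> {..m}"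
        then have "0 \<le> node T m k" "node T m k \<le> node T m (Suc k)"
          using T by (auto intro: node_bounds node_mono)
        then show "a (node T m k) * (h u * indicator {0..node T m (Suc k)} u - h u * indicator {0..node T m k} u)
          = a (node T m k) * indicator {node T m k<..node T m (Suc k)} u * h u"
          by (auto simp: indicator_def)
      qed
      also have "\<dots> = grid_fun T m (\<lambda>k. a (node T m k)) u * h u"
        by (simp only: grid_fun_def sum_distrib_right)
      also have "\<dots> = r m u"
        using grid_fun_outside[OF T, of u m] by (cases "u \<in> {0<..T}") (auto simp: r_def)
      finally show "(\<Sum>k\<le>m. a (node T m k) * (h u * indicator {0..node T m (Suc k)} u - h u * indicator {0..node T m k} u))
        = r m u" .
    qed
    finally show ?thesis .
  qed
  note [measurable] = wiener_integral_measurable(2)[OF R] wiener_integral_measurable[OF G]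
  have J [measurable]: "J \<in> borel_measurable M"
    unfolding J_def by measurable
  \<comment> \<open>The equation for \<open>y\<close> holds almost surely at each fixed time. All
    partitions together have countably many nodes, so a single null set serves for all of
    them.\<close>
  have "AE \<omega> in M. \<forall>m. \<forall>k\<in>{..Suc m}. y (node T m k) \<omega> = y 0 \<omega> + I (node T m k) \<omega>"
    unfolding AE_all_countable by (intro allI AE_finite_allI yI node_in) auto
  with y have lim: "AE \<omega> in M. (\<lambda>m. R m \<omega>) \<longlonglongrightarrow>
      a T * y T \<omega> - a 0 * y 0 \<omega> - (LINT u:{0..T}|lborel. a' u * y u \<omega>)"
  proof eventually_elim
    case (elim \<omega>)
    have "R m \<omega> = a T * y T \<omega> - a 0 * y 0 \<omega>
        - (\<Sum>k\<le>m. (a (node T m (Suc k)) - a (node T m k)) * y (node T m (Suc k)) \<omega>)" for m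
    proof -
      \<comment> \<open>Summation by parts: an increment of the product \<open>z\<close> is
        \<open>a\<close> at the left node times the increment of \<open>y\<close>, plus the
        increment of \<open>a\<close> times \<open>y\<close> at the right node. The increments of
        \<open>z\<close> telescope to the boundary terms.\<close>
      define z where "z k = a (node T m k) * y (node T m k) \<omega>" for k
      have "R m \<omega> = (\<Sum>k\<le>m. a (node T m k) * (y (node T m (Suc k)) \<omega> - y (node T m k) \<omega>))"
        unfolding R_def using elim(2) by (intro sum.cong) auto
      also have "\<dots> = (\<Sum>k\<le>m. (z (Suc k) - z k)
          - (a (node T m (Suc k)) - a (node T m k)) * y (node T m (Suc k)) \<omega>)"
        by (intro sum.cong) (auto simp: z_def algebra_simps)
      also have "\<dots> = (\<Sum>k\<le>m. z (Suc k) - z k)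
          - (\<Sum>k\<le>m. (a (node T m (Suc k)) - a (node T m k)) * y (node T m (Suc k)) \<omega>)"
        by (rule sum_subtractf)
      also have "(\<Sum>k\<le>m. z (Suc k) - z k) = z (Suc m) - z 0"
        by (induction m) auto
      finally show ?thesis by (simp add: z_def)
    qed
    then show ?case
      by (simp only:) (intro tendsto_diff tendsto_const riemann_stieltjes_sum_tendsto T a a' elim(1); assumption)
  qed
  have R_J: "AE \<omega> in M. (\<lambda>m. R m \<omega>) \<longlonglongrightarrow> J \<omega>"
    using lim by eventually_elim (auto simp: J_def limI)
  have G_J: "(\<lambda>m. \<integral>\<^sup>+\<omega>. ennreal ((G m \<omega> - J \<omega>)\<^sup>2) \<partial>M) \<longlonglongrightarrow> 0"
    and g_f: "(\<lambda>m. \<integral>\<^sup>+u. ennreal ((g m u - f u)\<^sup>2) \<partial>lborel) \<longlonglongrightarrow> 0"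
  proof -
    have eq: "g m u * (1 * indicator {0<..T} u) = g m u" for m u
      using grid_fun_outside[OF T, of u m] by (cases "u \<in> {0<..T}") (auto simp: g_def)
    have "(\<lambda>m. \<integral>\<^sup>+u. ennreal ((g m u * (1 * indicator {0<..T} u) - f u)\<^sup>2) \<partial>lborel) \<longlonglongrightarrow> 0"
      using grid_fun_L2_tendsto[OF ah continuous_on_const[of _ 1] T, of 0]
      by (simp only: g_def f_def mult_1_right)
    then show g_f: "(\<lambda>m. \<integral>\<^sup>+u. ennreal ((g m u - f u)\<^sup>2) \<partial>lborel) \<longlonglongrightarrow> 0"
      by (simp only: eq)
    have "(\<lambda>m. \<integral>\<^sup>+u. ennreal ((r m u - f u)\<^sup>2) \<partial>lborel) \<longlonglongrightarrow> 0"
      using grid_fun_L2_tendsto[OF a_cont h T, of 0] by (simp add: r_def f_def)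
    moreover have "f \<in> borel_measurable borel"
      using borel_measurable_continuous_times_indicator[OF ah] by (simp add: f_def[abs_def])
    ultimately show "(\<lambda>m. \<integral>\<^sup>+\<omega>. ennreal ((G m \<omega> - J \<omega>)\<^sup>2) \<partial>M) \<longlonglongrightarrow> 0"
      using wiener_integral_L2_limit[OF G R _ J g_f _ R_J] by blast
  qed
  \<comment> \<open>Constant in \<omega>, hence bounded and measurable for every \<open>F t\<close>.
    The number of steps is \<open>Suc m\<close>, because \<open>simple_process\<close> counts
    \<open>k < n\<close>.\<close>
  define \<xi> where "\<xi> m k \<omega> = a (node T m k) * h (node T m k)" for m k and \<omega> :: 'a
  have "has_ito_integral M F B T (\<lambda>u \<omega>. a u * h u) J"
    unfolding has_ito_integral_def
  proof (intro conjI exI allI ballI)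
    have "(\<lambda>u. a u * h u) \<in> borel_measurable (restrict_space lborel {0..T})"
      using borel_measurable_continuous_on_restrict[OF ah]
      by (simp cong: measurable_cong_sets add: sets_restrict_space)
    then show "(\<lambda>(\<omega>, u). a u * h u) \<in> borel_measurable (M \<Otimes>\<^sub>M restrict_space lborel {0..T})"
      using measurable_compose[OF measurable_snd] by (simp add: case_prod_unfold)
    show "J \<in> borel_measurable M" by (rule J)
    show "simple_process M F T (Suc m) (node T m) (\<xi> m)" for m
      using T unfolding simple_process_def by (auto simp: \<xi>_def[abs_def] intro: node_bounds node_mono)
    have value_eq: "simple_value (Suc m) (node T m) (\<xi> m) u \<omega> = g m u" for m u \<omega>
      by (simp add: simple_value_def g_def grid_fun_def \<xi>_def lessThan_Suc_atMost)
    have "(\<integral>\<^sup>+\<omega>. (\<integral>\<^sup>+u\<in>{0..T}. ennreal ((g m u - a u * h u)\<^sup>2) \<partial>lborel) \<partial>M)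
      = (\<integral>\<^sup>+u. ennreal ((g m u - f u)\<^sup>2) \<partial>lborel)" for m
    proof -
      have "(\<integral>\<^sup>+u\<in>{0..T}. ennreal ((g m u - a u * h u)\<^sup>2) \<partial>lborel) = (\<integral>\<^sup>+u. ennreal ((g m u - f u)\<^sup>2) \<partial>lborel)"
      proof (rule nn_integral_cong_AE)
        \<comment> \<open>The two sides can differ only at 0, where \<open>g m\<close> and
          \<open>f\<close> vanish but \<open>a u * h u\<close> need not.\<close>
        show "AE u in lborel. ennreal ((g m u - a u * h u)\<^sup>2) * indicator {0..T} u = ennreal ((g m u - f u)\<^sup>2)"
          using AE_lborel_singleton[of 0]
        proof eventually_elim
          case (elim u)
          then show ?case
            using grid_fun_outside[OF T, of u m] by (cases "u \<in> {0<..T}") (auto simp: g_def f_def)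
        qed
      qed
      then show ?thesis by (simp add: emeasure_space_1)
    qed
    with g_f show "(\<lambda>m. \<integral>\<^sup>+\<omega>. (\<integral>\<^sup>+u\<in>{0..T}. ennreal ((simple_value (Suc m) (node T m) (\<xi> m) u \<omega> - a u * h u)\<^sup>2)
        \<partial>lborel) \<partial>M) \<longlonglongrightarrow> 0"
      by (simp add: value_eq)
    have "simple_integral B (Suc m) (node T m) (\<xi> m) \<omega> = G m \<omega>" for m \<omega>
      by (simp add: simple_integral_def G_def \<xi>_def lessThan_Suc_atMost)
    with G_J show "(\<lambda>m. \<integral>\<^sup>+\<omega>. ennreal ((norm (simple_integral B (Suc m) (node T m) (\<xi> m) \<omega> - J \<omega>))\<^sup>2) \<partial>M)
        \<longlonglongrightarrow> 0"
      by simp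
  qed simp
  moreover have "AE \<omega> in M. a T * y T \<omega> = a 0 * y 0 \<omega> + (LINT u:{0..T}|lborel. a' u * y u \<omega>) + J \<omega>"
    using lim R_J
  proof eventually_elim
    case (elim \<omega>)
    from LIMSEQ_unique[OF elim] show ?case by simp
  qed
  ultimately show ?thesis by blast
qed

end

section \<open>The graph-Fourier modes\<close>

text \<open>With D = 1 + m q^2 / \<sigma>^2 and a = D^(-1/2) the logarithmic derivative of a is
  -D'/(2D). Since \<sigma>^2 + m q^2 = \<sigma>^2 D, this is -m c, and a^2 times 2 q q' is 2
  \<sigma>^2 c; so c is the common source of drift and diffusion.\<close>

lemma mode_factor:
  fixes \<kappa> \<sigma> m u :: real
  assumes \<sigma>: "0 < \<sigma>" and m: "0 < m"
  shows mode_factor_deriv: "((\<lambda>u. 1 / sqrt (1 + (\<kappa> * u)\<^sup>2 / \<sigma>\<^sup>2 * m)) has_real_derivative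
      - m * (\<kappa> * u * \<kappa> / (\<sigma>\<^sup>2 + m * (\<kappa> * u)\<^sup>2)) * (1 / sqrt (1 + (\<kappa> * u)\<^sup>2 / \<sigma>\<^sup>2 * m))) (at u)"
    and mode_factor_diffusion: "1 / sqrt (1 + (\<kappa> * u)\<^sup>2 / \<sigma>\<^sup>2 * m) * sqrt (2 * (\<kappa> * u) * \<kappa>)
      = sqrt (2 * \<sigma>\<^sup>2 * (\<kappa> * u * \<kappa> / (\<sigma>\<^sup>2 + m * (\<kappa> * u)\<^sup>2)))"
proof -
  define D where "D u = 1 + (\<kappa> * u)\<^sup>2 / \<sigma>\<^sup>2 * m" for u
  have D: "0 < D u" for u
    unfolding D_def using m by (intro add_pos_nonneg mult_nonneg_nonneg) auto
  have \<sigma>D: "\<sigma>\<^sup>2 + m * (\<kappa> * u)\<^sup>2 = \<sigma>\<^sup>2 * D u" for u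
    using \<sigma> by (simp add: D_def distrib_left)
  have "(D has_real_derivative 2 * \<kappa>\<^sup>2 * u / \<sigma>\<^sup>2 * m) (at u)"
    unfolding D_def[abs_def] using \<sigma> by (auto intro!: derivative_eq_intros simp: power2_eq_square)
  moreover have "((\<lambda>x. 1 / sqrt x) has_real_derivative - 1 / (2 * D u * sqrt (D u))) (at (D u))"
    using D[of u] by (auto intro!: derivative_eq_intros simp: field_simps)
  ultimately have "((\<lambda>u. 1 / sqrt (D u)) has_real_derivative
      - 1 / (2 * D u * sqrt (D u)) * (2 * \<kappa>\<^sup>2 * u / \<sigma>\<^sup>2 * m)) (at u)"
    by (rule DERIV_chain2[rotated])
  also have "- 1 / (2 * D u * sqrt (D u)) * (2 * \<kappa>\<^sup>2 * u / \<sigma>\<^sup>2 * m)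
    = - m * (\<kappa> * u * \<kappa> / (\<sigma>\<^sup>2 * D u)) * (1 / sqrt (D u))"
    by (simp add: power2_eq_square mult_ac)
  finally show "((\<lambda>u. 1 / sqrt (1 + (\<kappa> * u)\<^sup>2 / \<sigma>\<^sup>2 * m)) has_real_derivative
      - m * (\<kappa> * u * \<kappa> / (\<sigma>\<^sup>2 + m * (\<kappa> * u)\<^sup>2)) * (1 / sqrt (1 + (\<kappa> * u)\<^sup>2 / \<sigma>\<^sup>2 * m))) (at u)"
    by (simp only: \<sigma>D D_def)
  have "1 / sqrt (D u) * sqrt (2 * (\<kappa> * u) * \<kappa>) = sqrt (2 * (\<kappa> * u) * \<kappa> / D u)"
    by (simp add: real_sqrt_divide)
  also have "2 * (\<kappa> * u) * \<kappa> / D u = 2 * \<sigma>\<^sup>2 * (\<kappa> * u * \<kappa> / (\<sigma>\<^sup>2 * D u))"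
    using \<sigma> by simp
  finally show "1 / sqrt (1 + (\<kappa> * u)\<^sup>2 / \<sigma>\<^sup>2 * m) * sqrt (2 * (\<kappa> * u) * \<kappa>)
      = sqrt (2 * \<sigma>\<^sup>2 * (\<kappa> * u * \<kappa> / (\<sigma>\<^sup>2 + m * (\<kappa> * u)\<^sup>2)))"
    by (simp only: \<sigma>D D_def)
qed

theorem corollary1:
  fixes M :: "'a measure"
    and Adj U L L\<delta> :: "real^'n^'n"
    and A :: "real \<Rightarrow> real^'n^'n"
    and lam \<mu> :: "'n \<Rightarrow> real"
    and lam_max \<delta> \<kappa> \<sigma> tmax :: real
    and q :: "real \<Rightarrow> real"
    and c :: "'n \<Rightarrow> real \<Rightarrow> real"
    and x0 :: "'a \<Rightarrow> real^'n"
    and W xt x :: "real \<Rightarrow> 'a \<Rightarrow> real^'n"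
    and F :: "real \<Rightarrow> 'a measure"
  assumes "transpose Adj = Adj" and "\<forall>i j. 0 \<le> Adj $ i $ j"
    and "L = norm_laplacian Adj"
    and "L = U ** diag_matrix lam ** transpose U" and "transpose U ** U = mat 1"
    and "lam_max = Max (range lam)" and "0 < lam_max"
    and "0 < \<delta>"
    and "L\<delta> = (1 / lam_max) *\<^sub>R L + \<delta> *\<^sub>R mat 1"
    and "\<mu> = (\<lambda>i. lam i / lam_max + \<delta>)"
    and "0 < \<kappa>" and "q = (\<lambda>t. \<kappa> * t)"
    and "0 < \<sigma>" and "0 < tmax"
    and "prob_space M"
    and "x0 \<in> borel_measurable M"
    and "brownian_motion M (natural_filtration M W) W"
    and "rv_indep_process M x0 W"
    and "F = augmented_filtration M x0 W"
    and "sde_solution M F W tmax (\<lambda>t y. 0) (\<lambda>t y. sqrt (2 * q t * deriv q t)) xt"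
    and "AE \<omega> in M. xt 0 \<omega> = x0 \<omega>"
    and "A = (\<lambda>t. inv_sqrt_matrix (mat 1 + ((q t)\<^sup>2 / \<sigma>\<^sup>2) *\<^sub>R L\<delta>))"
    and "x = (\<lambda>t \<omega>. A t *v xt t \<omega>)"
    and "c = (\<lambda>i t. q t * deriv q t / (\<sigma>\<^sup>2 + \<mu> i * (q t)\<^sup>2))"
  shows "\<forall>i. sde_solution M F (\<lambda>t \<omega>. (transpose U *v W t \<omega>) $ i) tmax
               (\<lambda>t y. - \<mu> i * c i t * y)
               (\<lambda>t y. sqrt (2 * \<sigma>\<^sup>2 * c i t))
               (\<lambda>t \<omega>. (transpose U *v x t \<omega>) $ i)"
proof
  fix i
  note Adj = assms(1,2) and L = assms(3,4) and U = assms(5) and lam_max = assms(7)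
    and \<delta> = assms(8) and L\<delta> = assms(9) and \<mu> = assms(10) and q = assms(12) and \<sigma> = assms(13)
    and A = assms(22) and x = assms(23) and c = assms(24)
  have "0 \<le> lam j" for j
  proof (rule conjugate_diag_eigenvalue_nonneg[OF U])
    show "0 \<le> v \<bullet> ((U ** diag_matrix lam ** transpose U) *v v)" for v
      using norm_laplacian_nonneg[of Adj v] Adj L by simp
  qed
  then have \<mu>_pos: "0 < \<mu> j" for j
    using lam_max \<delta> by (simp add: \<mu> add_nonneg_pos)
  have deriv_q: "deriv q t = \<kappa>" for t
    unfolding q by (rule DERIV_imp_deriv) (auto intro!: derivative_eq_intros)
  \<comment> \<open>\<open>a u\<close> is the eigenvalue of \<open>A u\<close> on the i-th column of
    \<open>U\<close>, and \<open>h\<close> below is the diffusion coefficient of \<open>xt\<close>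
    with the derivative of \<open>q\<close> inserted.\<close>
  define a where "a u = 1 / sqrt (1 + (\<kappa> * u)\<^sup>2 / \<sigma>\<^sup>2 * \<mu> i)" for u
  define h where "h u = sqrt (2 * (\<kappa> * u) * \<kappa>)" for u
  define a' where "a' u = - \<mu> i * c i u * a u" for u
  have c': "c i u = \<kappa> * u * \<kappa> / (\<sigma>\<^sup>2 + \<mu> i * (\<kappa> * u)\<^sup>2)" for u
    unfolding c deriv_q by (simp add: q)
  have a: "(a has_real_derivative a' u) (at u)" for u
    unfolding a_def[abs_def] a'_def c' by (rule mode_factor_deriv[OF \<sigma> \<mu>_pos])
  have ah: "a u * h u = sqrt (2 * \<sigma>\<^sup>2 * c i u)" for u
    unfolding a_def h_def c' by (rule mode_factor_diffusion[OF \<sigma> \<mu>_pos])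
  have a_cont: "continuous_on S a" for S
    using a by (meson DERIV_isCont continuous_at_imp_continuous_on)
  have "\<sigma>\<^sup>2 + \<mu> i * (\<kappa> * u)\<^sup>2 > 0" for u
    using \<sigma> \<mu>_pos[of i] by (intro add_pos_nonneg) auto
  then have c_cont: "continuous_on S (c i)" for S
    unfolding c'[abs_def] by (intro continuous_intros) (auto simp: less_imp_neq[symmetric])
  have a'_cont: "continuous_on S a'" for S
    unfolding a'_def[abs_def] by (intro continuous_intros a_cont c_cont)
  define v where "v = column i U"
  have v: "norm v = 1"
    unfolding v_def by (rule norm_column_orthogonal[OF U])
  define B where "B t \<omega> = v \<bullet> W t \<omega>" for t \<omega>
  define y where "y t \<omega> = v \<bullet> xt t \<omega>" for t \<omega>
  have X: "(transpose U *v x t \<omega>) $ i = a t * y t \<omega>" for t \<omega>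
  proof -
    have U': "U ** transpose U = mat 1"
      using U by (simp add: matrix_left_right_inverse)
    \<comment> \<open>The identity is also written in the eigenbasis, so that
      \<open>L\<delta>\<close> and the matrix under the inverse root become single conjugated
      diagonal matrices.\<close>
    have one: "mat 1 = U ** diag_matrix (\<lambda>_. 1) ** transpose U"
      by (simp add: diag_matrix_one U')
    have "mat 1 + ((q t)\<^sup>2 / \<sigma>\<^sup>2) *\<^sub>R L\<delta> = U ** diag_matrix (\<lambda>j. 1 + (\<kappa> * t)\<^sup>2 / \<sigma>\<^sup>2 * \<mu> j) ** transpose U"
      unfolding L\<delta> L(2) one conjugate_diag_scale conjugate_diag_add by (simp add: \<mu> q)
    moreover have "0 < 1 + (\<kappa> * t)\<^sup>2 / \<sigma>\<^sup>2 * \<mu> j" for j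
      using \<mu>_pos[of j] by (intro add_pos_nonneg mult_nonneg_nonneg) auto
    ultimately have "A t = U ** diag_matrix (\<lambda>j. 1 / sqrt (1 + (\<kappa> * t)\<^sup>2 / \<sigma>\<^sup>2 * \<mu> j)) ** transpose U"
      by (simp add: A inv_sqrt_matrix_conjugate_diag[OF U])
    then show ?thesis
      by (simp only: x transpose_conjugate_diag_mult_vec[OF U])
        (simp only: transpose_mult_vec_component a_def y_def v_def)
  qed
  have sde: "sde_solution M F W tmax (\<lambda>t y. 0) (\<lambda>t y. h t) xt"
    using assms(20) unfolding deriv_q by (simp add: q h_def[abs_def])
  \<comment> \<open>\<open>sde_solution\<close> for \<open>xt\<close> contains the Brownian property
    of \<open>W\<close> relative to \<open>F\<close> itself, and projection on \<open>v\<close>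
    preserves it.\<close>
  have bm: "brownian_motion M F B"
    unfolding B_def[abs_def] using assms(15) sde v
    by (intro brownian_motion_inner) (auto simp: sde_solution_def)
  interpret real_brownian_motion M F B
    using assms(15) bm by (intro real_brownian_motion.intro real_brownian_motion_axioms.intro)
  have h: "continuous_on S h" for S
    unfolding h_def[abs_def] by (intro continuous_intros)
  have "\<exists>I. has_ito_integral M F W s (\<lambda>u \<omega>. h u) I \<and> (AE \<omega> in M. xt s \<omega> = xt 0 \<omega> + I \<omega>)"
    if "s \<in> {0..tmax}" for s
    using sde that by (simp add: sde_solution_def)
  then obtain I where ito: "\<And>s. s \<in> {0..tmax} \<Longrightarrow> has_ito_integral M F W s (\<lambda>u \<omega>. h u) (I s)"
    and I: "\<And>s. s \<in> {0..tmax} \<Longrightarrow> AE \<omega> in M. xt s \<omega> = xt 0 \<omega> + I s \<omega>"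
    by metis
  have wiener: "wiener_integral (\<lambda>u. h u * indicator {0..s} u) (\<lambda>\<omega>. v \<bullet> I s \<omega>)" if "s \<in> {0..tmax}" for s
  proof (rule wiener_integral_if_has_ito_integral[OF ito[OF that] _ v])
    show "(\<lambda>u. h u * indicator {0..s} u) \<in> borel_measurable borel"
      using borel_measurable_continuous_on_indicator[OF _ h, of "{0..s}"] by (simp add: mult.commute)
  qed (simp add: B_def[abs_def])
  have y_eq: "AE \<omega> in M. y s \<omega> = y 0 \<omega> + v \<bullet> I s \<omega>" if "s \<in> {0..tmax}" for s
    using I[OF that] by eventually_elim (simp add: y_def inner_add_right)
  have y_cont: "AE \<omega> in M. continuous_on {0..tmax} (\<lambda>s. y s \<omega>)"
  proof -
    have "AE \<omega> in M. continuous_on {0..tmax} (\<lambda>s. xt s \<omega>)"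
      using sde by (simp add: sde_solution_def)
    then show ?thesis
      unfolding y_def by eventually_elim (intro continuous_intros)
  qed
  have W: "(\<lambda>t \<omega>. (transpose U *v W t \<omega>) $ i) = B"
    by (simp only: B_def[abs_def] v_def transpose_mult_vec_component)
  show "sde_solution M F (\<lambda>t \<omega>. (transpose U *v W t \<omega>) $ i) tmax (\<lambda>t y. - \<mu> i * c i t * y)
      (\<lambda>t y. sqrt (2 * \<sigma>\<^sup>2 * c i t)) (\<lambda>t \<omega>. (transpose U *v x t \<omega>) $ i)"
    unfolding W X sde_solution_def ah[symmetric]
  proof (intro conjI ballI)
    show "brownian_motion M F B" by (rule bm)
    show "AE \<omega> in M. continuous_on {0..tmax} (\<lambda>t. a t * y t \<omega>)"
      using y_cont by eventually_elim (intro continuous_intros a_cont)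
    show "AE \<omega> in M. set_integrable lborel {0..tmax} (\<lambda>u. - \<mu> i * c i u * (a u * y u \<omega>))"
      using y_cont by eventually_elim (intro borel_integrable_atLeastAtMost' continuous_intros a_cont c_cont)
    fix t assume t: "t \<in> {0..tmax}"
    have "xt t \<in> borel_measurable (F t)"
      using sde t by (simp add: sde_solution_def)
    then show "(\<lambda>\<omega>. a t * y t \<omega>) \<in> borel_measurable (F t)"
      unfolding y_def by measurable
    have "\<exists>J. has_ito_integral M F B t (\<lambda>u \<omega>. a u * h u) J \<and>
      (AE \<omega> in M. a t * y t \<omega> = a 0 * y 0 \<omega> + (LINT u:{0..t}|lborel. a' u * y u \<omega>) + J \<omega>)"
    \<comment> \<open>The integral equation is demanded separately at each time, so the horizon here
      is \<open>t\<close> rather than \<open>tmax\<close>.\<close>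
    proof (rule has_ito_integral_integration_by_parts[where I="\<lambda>s \<omega>. v \<bullet> I s \<omega>"])
      show "AE \<omega> in M. continuous_on {0..t} (\<lambda>s. y s \<omega>)"
        using y_cont by eventually_elim (rule continuous_on_subset, use t in auto)
    qed (use t wiener y_eq a a'_cont h in auto)
    then show "\<exists>J. has_ito_integral M F B t (\<lambda>u \<omega>. a u * h u) J \<and>
      (AE \<omega> in M. a t * y t \<omega> = a 0 * y 0 \<omega> + (LINT u:{0..t}|lborel. - \<mu> i * c i u * (a u * y u \<omega>)) + J \<omega>)"
      by (simp add: a'_def mult.assoc)
  qed
qed

end
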